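(* Let $(\Lambda^1,g)$ be an oriented 8-dimensional Euclidean vector space and let $\mathfrak{I}_g\subset\Lambda^3$ denote the set of 3-forms $\rho$ whose Clifford action on spinors induces an isometry $\Delta_+\to\Delta_-$. (a) If a 3-form $\rho$ lies in $\mathfrak{I}_g$, then $\rho$ is of unit length and there exists a Lie bracket $[\cdot,\cdot]$ on $\Lambda^1$ such that $$\rho(x,y,z)=g([x,y],z)\quad\text{for all }x,y,z\in\Lambda^1 .$$ In particular, the adjoint group of the resulting Lie algebra acts as a group of isometries on $(\Lambda^1,g)$. (b) Conversely, if there exists a Lie algebra structure $[\cdot,\cdot]$ on $\Lambda^1$ whose adjoint group leaves $g$ invariant, then the 3-form defined by $\rho(x,y,z)=g([x,y],z)$ and divided by its norm lies in $\mathfrak{I}_g$.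
   Context: Vectors and covectors are identified via $g$. The Clifford algebra of $(\Lambda^1,g)$ has relations $v\cdot v=-g(v,v)$, and it acts on the real 16-dimensional spinor module $\Delta=\Delta_+\oplus\Delta_-$, where $\Delta_\pm$ are the two 8-dimensional real half-spin representations of $Spin(8)$, equipped with the $Spin(8)$-invariant Euclidean inner product. A form $\sum_{i<j<k}c_{ijk}e_i\wedge e_j\wedge e_k$ (for an orthonormal basis $e_1,\dots,e_8$) acts as the Clifford element $\sum_{i<j<k}c_{ijk}e_i\cdot e_j\cdot e_k$, so a 3-form maps $\Delta_\pm$ to $\Delta_\mp$. The norm of a 3-form is $\|\rho\|^2=\sum_{i<j<k}c_{ijk}^2$. *)

theory Defs
  imports "HOL-Analysis.Analysis"
begin

text \<open>
  The Euclidean space is a type of class \<open>euclidean_space\<close> with \<open>DIM('v) = 8\<close>; the metric is the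
  inner product of the class, and vectors and covectors are identified through it. An orientation
  is specified by an ordered orthonormal basis \<open>e\<close>, which is declared positive; it is only used to
  tell the two half-spin spaces apart.
\<close>

definition orthonormal_frame :: "(nat \<Rightarrow> 'v::real_inner) \<Rightarrow> bool" where
  "orthonormal_frame e \<longleftrightarrow> (\<forall>i\<in>{1..8}. \<forall>j\<in>{1..8}. e i \<bullet> e j = (if i = j then 1 else 0))"


subsection \<open>Spinors\<close>

text \<open>
  By the universal property, a module over the Clifford algebra with relations
  \<open>v \<cdot> v = - g(v, v)\<close> is a linear action \<open>cl\<close> of the vectors satisfying these relations.
  In dimension 8 this algebra is the algebra of real 16 by 16 matrices, so its module of real
  dimension 16 is unique up to isomorphism: it is the spinor module.

  Invariance under \<open>Spin(8)\<close> alone fixes an inner product only up to separate factors on the two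
  half-spin spaces. The standard inner product is the one for which Clifford multiplication by
  unit vectors is also isometric, and this is what the last conjunct says.
\<close>

definition spinor_module :: "('v::euclidean_space \<Rightarrow> 's::euclidean_space \<Rightarrow> 's) \<Rightarrow> bool" where
  "spinor_module cl \<longleftrightarrow>
     DIM('s) = 16 \<and>
     bilinear cl \<and>
     (\<forall>v s. cl v (cl v s) = - (v \<bullet> v) *\<^sub>R s) \<and>
     (\<forall>v s t. norm v = 1 \<longrightarrow> cl v s \<bullet> cl v t = s \<bullet> t)"

definition clifford_volume :: "('v \<Rightarrow> 's \<Rightarrow> 's) \<Rightarrow> (nat \<Rightarrow> 'v) \<Rightarrow> 's \<Rightarrow> 's" where
  "clifford_volume cl e s =
     cl (e 1) (cl (e 2) (cl (e 3) (cl (e 4) (cl (e 5) (cl (e 6) (cl (e 7) (cl (e 8) s)))))))"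

text \<open>
  The volume element squares to the identity and commutes with the even part of the Clifford
  algebra; its eigenspaces are the two half-spin representations.
\<close>

definition half_spin_plus :: "('v \<Rightarrow> 's::real_vector \<Rightarrow> 's) \<Rightarrow> (nat \<Rightarrow> 'v) \<Rightarrow> 's set" where
  "half_spin_plus cl e = {s. clifford_volume cl e s = s}"

definition half_spin_minus :: "('v \<Rightarrow> 's::real_vector \<Rightarrow> 's) \<Rightarrow> (nat \<Rightarrow> 'v) \<Rightarrow> 's set" where
  "half_spin_minus cl e = {s. clifford_volume cl e s = - s}"


subsection \<open>3-forms\<close>

definition three_form :: "('v::real_vector \<Rightarrow> 'v \<Rightarrow> 'v \<Rightarrow> real) \<Rightarrow> bool" where
  "three_form \<rho> \<longleftrightarrow>
     (\<forall>y z. linear (\<lambda>x. \<rho> x y z)) \<and>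
     (\<forall>x z. linear (\<lambda>y. \<rho> x y z)) \<and>
     (\<forall>x y. linear (\<lambda>z. \<rho> x y z)) \<and>
     (\<forall>x y. \<rho> x x y = 0 \<and> \<rho> x y x = 0 \<and> \<rho> y x x = 0)"

text \<open>
  The coefficient of \<open>e\<^sub>i \<and> e\<^sub>j \<and> e\<^sub>k\<close> in \<open>\<rho>\<close> is \<open>\<rho>(e\<^sub>i, e\<^sub>j, e\<^sub>k)\<close>. The norm and the Clifford action
  do not depend on the orthonormal basis, nor does the set \<open>isometric_forms\<close>; see
  \<open>form_norm_frame_indep\<close>, \<open>clifford_form_frame_indep\<close> and \<open>isometric_forms_frame_indep\<close> below.
\<close>

definition index_triples :: "(nat \<times> nat \<times> nat) set" where
  "index_triples = {(i, j, k). 1 \<le> i \<and> i < j \<and> j < k \<and> k \<le> 8}"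

definition form_norm :: "(nat \<Rightarrow> 'v) \<Rightarrow> ('v \<Rightarrow> 'v \<Rightarrow> 'v \<Rightarrow> real) \<Rightarrow> real" where
  "form_norm e \<rho> = sqrt (\<Sum>(i, j, k)\<in>index_triples. (\<rho> (e i) (e j) (e k))\<^sup>2)"

definition clifford_form ::
  "('v \<Rightarrow> 's::real_vector \<Rightarrow> 's) \<Rightarrow> (nat \<Rightarrow> 'v) \<Rightarrow> ('v \<Rightarrow> 'v \<Rightarrow> 'v \<Rightarrow> real) \<Rightarrow> 's \<Rightarrow> 's" where
  "clifford_form cl e \<rho> s =
     (\<Sum>(i, j, k)\<in>index_triples. \<rho> (e i) (e j) (e k) *\<^sub>R cl (e i) (cl (e j) (cl (e k) s)))"

definition isometry_onto :: "('a::real_inner \<Rightarrow> 'b::real_inner) \<Rightarrow> 'a set \<Rightarrow> 'b set \<Rightarrow> bool" where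
  "isometry_onto f S T \<longleftrightarrow> f ` S = T \<and> (\<forall>x\<in>S. \<forall>y\<in>S. f x \<bullet> f y = x \<bullet> y)"

definition isometric_forms ::
  "('v::euclidean_space \<Rightarrow> 's::euclidean_space \<Rightarrow> 's) \<Rightarrow> (nat \<Rightarrow> 'v) \<Rightarrow> ('v \<Rightarrow> 'v \<Rightarrow> 'v \<Rightarrow> real) set"
  where
  "isometric_forms cl e =
     {\<rho>. three_form \<rho> \<and>
         isometry_onto (clifford_form cl e \<rho>) (half_spin_plus cl e) (half_spin_minus cl e)}"


subsection \<open>Lie brackets and the adjoint group\<close>

definition lie_bracket :: "('v::real_vector \<Rightarrow> 'v \<Rightarrow> 'v) \<Rightarrow> bool" where
  "lie_bracket br \<longleftrightarrow>
     bilinear br \<and>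
     (\<forall>x. br x x = 0) \<and>
     (\<forall>x y z. br x (br y z) + br y (br z x) + br z (br x y) = 0)"

definition exp_ad :: "('v::euclidean_space \<Rightarrow> 'v \<Rightarrow> 'v) \<Rightarrow> 'v \<Rightarrow> 'v \<Rightarrow> 'v" where
  "exp_ad br x y = (\<Sum>n. (1 / fact n) *\<^sub>R ((br x) ^^ n) y)"

text \<open>
  The adjoint group is the connected Lie subgroup of the general linear group whose Lie algebra is
  the image of \<open>ad\<close>; it is the subgroup generated by the maps \<open>exp (ad x)\<close>.
\<close>

inductive_set adjoint_group :: "('v::euclidean_space \<Rightarrow> 'v \<Rightarrow> 'v) \<Rightarrow> ('v \<Rightarrow> 'v) set"
  for br :: "'v \<Rightarrow> 'v \<Rightarrow> 'v" where
  one: "id \<in> adjoint_group br"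
| exp: "exp_ad br x \<in> adjoint_group br"
| mult: "\<phi> \<in> adjoint_group br \<Longrightarrow> \<psi> \<in> adjoint_group br \<Longrightarrow> \<phi> \<circ> \<psi> \<in> adjoint_group br"
| inverse: "\<phi> \<in> adjoint_group br \<Longrightarrow> inv \<phi> \<in> adjoint_group br"


subsection \<open>Independence of the choice of orthonormal basis\<close>

lemma orthonormal_frame_expansion:
  fixes e :: "nat \<Rightarrow> 'v::euclidean_space"
  assumes "orthonormal_frame e" and "DIM('v) = 8"
  shows "x = (\<Sum>i\<in>{1..8}. (x \<bullet> e i) *\<^sub>R e i)"
proof -
  have e: "e i \<bullet> e j = (if i = j then 1 else 0)" if "i \<in> {1..8}" "j \<in> {1..8}" for i j
    using assms(1) that by (auto simp: orthonormal_frame_def)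
  have inj: "inj_on e {1..8}"
  proof (rule inj_onI)
    fix i j assume "i \<in> {1..8}" "j \<in> {1..8}" "e i = e j"
    then show "i = j" using e[of i j] e[of i i] by (auto split: if_splits)
  qed
  have "pairwise orthogonal (e ` {1..8})"
    using e by (auto simp: pairwise_def orthogonal_def)
  moreover have "0 \<notin> e ` {1..8}"
    using e by fastforce
  ultimately have "independent (e ` {1..8})"
    by (rule pairwise_orthogonal_independent)
  moreover have "card (e ` {1..8}) = 8"
    using inj by (simp add: card_image)
  ultimately have span: "span (e ` {1..8}) = UNIV"
    using assms(2) by (metis card_eq_dim dim_UNIV finite_imageI finite_atLeastAtMost subset_UNIV top.extremum_uniqueI)
  let ?r = "x - (\<Sum>i\<in>{1..8}. (x \<bullet> e i) *\<^sub>R e i)"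
  have "orthogonal ?r b" if "b \<in> e ` {1..8}" for b
  proof -
    from that obtain j where j: "j \<in> {1..8}" "b = e j" by auto
    have "(\<Sum>i\<in>{1..8}. (x \<bullet> e i) *\<^sub>R e i) \<bullet> e j = (\<Sum>i\<in>{1..8}. if i = j then x \<bullet> e i else 0)"
      unfolding inner_sum_left using j by (intro sum.cong) (auto simp: e)
    also have "\<dots> = x \<bullet> e j" using j by (simp add: sum.delta)
    finally show ?thesis using j by (simp add: orthogonal_def inner_diff_left)
  qed
  then have "orthogonal ?r ?r"
    using span by (intro orthogonal_to_span[of ?r "e ` {1..8}"]) auto
  then show ?thesis by (simp add: orthogonal_def)
qed

lemma frame_contraction:
  fixes e f :: "nat \<Rightarrow> 'v::euclidean_space" and B :: "'v \<Rightarrow> 'v \<Rightarrow> 'w::real_vector"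
  assumes e: "orthonormal_frame e" and f: "orthonormal_frame f" and d: "DIM('v) = 8"
    and B: "bilinear B"
  shows "(\<Sum>i\<in>{1..8}. B (e i) (e i)) = (\<Sum>i\<in>{1..8}. B (f i) (f i))"
proof -
  have ex: "B (e i) (e i) = (\<Sum>j\<in>{1..8}. \<Sum>k\<in>{1..8}. ((f j \<bullet> e i) * (f k \<bullet> e i)) *\<^sub>R B (f j) (f k))" for i
  proof -
    have l: "linear (\<lambda>x. B x y)" "linear (B y)" for y using B by (auto simp: bilinear_def)
    have "B (e i) (e i) = B (\<Sum>j\<in>{1..8}. (e i \<bullet> f j) *\<^sub>R f j) (\<Sum>k\<in>{1..8}. (e i \<bullet> f k) *\<^sub>R f k)"
      using orthonormal_frame_expansion[OF f d, of "e i"] by simp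
    also have "\<dots> = (\<Sum>j\<in>{1..8}. \<Sum>k\<in>{1..8}. ((f j \<bullet> e i) * (f k \<bullet> e i)) *\<^sub>R B (f j) (f k))"
    proof -
      have 1: "B (\<Sum>j\<in>{1..8}. c j *\<^sub>R f j) y = (\<Sum>j\<in>{1..8}. c j *\<^sub>R B (f j) y)" for c y
        by (simp add: linear_sum[OF l(1)] linear_scale[OF l(1)])
      have 2: "B y (\<Sum>j\<in>{1..8}. c j *\<^sub>R f j) = (\<Sum>j\<in>{1..8}. c j *\<^sub>R B y (f j))" for c y
        by (simp add: linear_sum[OF l(2)] linear_scale[OF l(2)])
      show ?thesis unfolding 1 unfolding 2 by (simp add: inner_commute scaleR_sum_right)
    qed
    finally show ?thesis .
  qed
  have "(\<Sum>i\<in>{1..8}. B (e i) (e i)) =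
      (\<Sum>j\<in>{1..8}. \<Sum>k\<in>{1..8}. \<Sum>i\<in>{1..8}. ((f j \<bullet> e i) * (f k \<bullet> e i)) *\<^sub>R B (f j) (f k))"
    unfolding ex by (subst sum.swap, rule sum.cong[OF refl], rule sum.swap)
  also have "\<dots> = (\<Sum>j\<in>{1..8}. \<Sum>k\<in>{1..8}. (f j \<bullet> f k) *\<^sub>R B (f j) (f k))"
  proof -
    have "(\<Sum>i\<in>{1..8}. (f j \<bullet> e i) * (f k \<bullet> e i)) = f j \<bullet> f k" for j k
    proof -
      have "f j \<bullet> f k = f j \<bullet> (\<Sum>i\<in>{1..8}. (f k \<bullet> e i) *\<^sub>R e i)"
        using orthonormal_frame_expansion[OF e d, of "f k"] by simp
      then show ?thesis by (simp add: inner_sum_right mult.commute)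
    qed
    then show ?thesis by (simp flip: scaleR_sum_left)
  qed
  also have "\<dots> = (\<Sum>j\<in>{1..8}. \<Sum>k\<in>{1..8}. if j = k then B (f j) (f k) else 0)"
    using f by (intro sum.cong refl) (auto simp: orthonormal_frame_def)
  also have "\<dots> = (\<Sum>i\<in>{1..8}. B (f i) (f i))"
    by simp
  finally show ?thesis .
qed

lemma finite_index_triples: "finite index_triples"
  by (rule finite_subset[of _ "{1..8} \<times> {1..8} \<times> {1..8}"]) (auto simp: index_triples_def)

lemma sum_index_triples:
  fixes F :: "nat \<Rightarrow> nat \<Rightarrow> nat \<Rightarrow> 'w::real_vector"
  assumes s1: "\<And>i j k. i \<in> {1..8} \<Longrightarrow> j \<in> {1..8} \<Longrightarrow> k \<in> {1..8} \<Longrightarrow> F j i k = F i j k"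
    and s2: "\<And>i j k. i \<in> {1..8} \<Longrightarrow> j \<in> {1..8} \<Longrightarrow> k \<in> {1..8} \<Longrightarrow> F i k j = F i j k"
    and z: "\<And>i k. i \<in> {1..8} \<Longrightarrow> k \<in> {1..8} \<Longrightarrow> F i i k = 0"
  shows "(\<Sum>(i, j, k)\<in>index_triples. F i j k) =
    (1 / 6) *\<^sub>R (\<Sum>i\<in>{1..8}. \<Sum>j\<in>{1..8}. \<Sum>k\<in>{1..8}. F i j k)"
proof -
  let ?A = "{1..8::nat} \<times> {1..8::nat} \<times> {1..8::nat}"
  let ?F = "\<lambda>(i, j, k). F i j k"
  have z2: "F i k k = 0" "F k i k = 0" if "i \<in> {1..8}" "k \<in> {1..8}" for i k
    using that z[of k i] s1[of k i k] s2[of k k i] by auto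
  define c where "c = (\<lambda>(i::nat, j::nat, k::nat).
     if i < j \<and> j < k then 0 else if i < k \<and> k < j then 1 else if j < i \<and> i < k then 2
     else if j < k \<and> k < i then 3 else if k < i \<and> i < j then 4 else if k < j \<and> j < i then 5 else 6::nat)"
  have cs: "c (i, j, k) = 0 \<longleftrightarrow> i < j \<and> j < k" "c (i, j, k) = 1 \<longleftrightarrow> i < k \<and> k < j"
    "c (i, j, k) = 2 \<longleftrightarrow> j < i \<and> i < k" "c (i, j, k) = 3 \<longleftrightarrow> j < k \<and> k < i"
    "c (i, j, k) = 4 \<longleftrightarrow> k < i \<and> i < j" "c (i, j, k) = 5 \<longleftrightarrow> k < j \<and> j < i" for i j k
    by (simp_all add: c_def)
  define P where "P = (\<lambda>m. {x \<in> ?A. c x = m})"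
  have Pm: "P 0 = {(i, j, k). (i, j, k) \<in> ?A \<and> i < j \<and> j < k}"
    "P 1 = {(i, j, k). (i, j, k) \<in> ?A \<and> i < k \<and> k < j}"
    "P 2 = {(i, j, k). (i, j, k) \<in> ?A \<and> j < i \<and> i < k}"
    "P 3 = {(i, j, k). (i, j, k) \<in> ?A \<and> j < k \<and> k < i}"
    "P 4 = {(i, j, k). (i, j, k) \<in> ?A \<and> k < i \<and> i < j}"
    "P 5 = {(i, j, k). (i, j, k) \<in> ?A \<and> k < j \<and> j < i}"
    unfolding P_def by (auto simp: cs cs(2)[unfolded One_nat_def])
  have P0: "P 0 = index_triples" by (auto simp: Pm index_triples_def)
  have fin: "finite (P m)" for m
    by (rule finite_subset[of _ ?A]) (auto simp: P_def)
  have "sum ?F ?A = sum ?F (\<Union>m\<in>{..<6}. P m)"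
  proof (rule sum.mono_neutral_right)
    show "\<forall>x\<in>?A - (\<Union>m\<in>{..<6}. P m). ?F x = 0"
    proof safe
      fix i j k :: nat
      assume a: "i \<in> {1..8}" "j \<in> {1..8}" "k \<in> {1..8}" and n: "(i, j, k) \<notin> (\<Union>m\<in>{..<6}. P m)"
      have "(i, j, k) \<notin> P 0" "(i, j, k) \<notin> P 1" "(i, j, k) \<notin> P 2" "(i, j, k) \<notin> P 3"
        "(i, j, k) \<notin> P 4" "(i, j, k) \<notin> P 5" using n by auto
      with a have "i = j \<or> j = k \<or> i = k" by (simp add: Pm Pm(2)[unfolded One_nat_def]) linarith
      then show "F i j k = 0" using a z z2 by auto
    qed
  qed (auto simp: P_def)
  also have "\<dots> = (\<Sum>m\<in>{..<6}. sum ?F (P m))"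
    using fin by (intro sum.UNION_disjoint) (auto simp: P_def)
  also have "\<dots> = (\<Sum>m\<in>{..<6::nat}. sum ?F index_triples)"
  proof (rule sum.cong[OF refl])
    fix m :: nat assume "m \<in> {..<6}"
    then have "m = 0 \<or> m = 1 \<or> m = 2 \<or> m = 3 \<or> m = 4 \<or> m = 5" by (simp, linarith)
    have p1: "sum ?F (P 1) = sum ?F (P 0)"
      by (rule sum.reindex_bij_witness[of _ "\<lambda>(i,j,k). (i,k,j)" "\<lambda>(i,j,k). (i,k,j)"]) (auto simp: Pm Pm(2)[unfolded One_nat_def] s2)
    have p2: "sum ?F (P 2) = sum ?F (P 0)"
      by (rule sum.reindex_bij_witness[of _ "\<lambda>(i,j,k). (j,i,k)" "\<lambda>(i,j,k). (j,i,k)"]) (auto simp: Pm Pm(2)[unfolded One_nat_def] s1)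
    have p3: "sum ?F (P 3) = sum ?F (P 1)"
      by (rule sum.reindex_bij_witness[of _ "\<lambda>(i,j,k). (j,i,k)" "\<lambda>(i,j,k). (j,i,k)"]) (auto simp: Pm Pm(2)[unfolded One_nat_def] s1)
    have p4: "sum ?F (P 4) = sum ?F (P 2)"
      by (rule sum.reindex_bij_witness[of _ "\<lambda>(i,j,k). (i,k,j)" "\<lambda>(i,j,k). (i,k,j)"]) (auto simp: Pm Pm(2)[unfolded One_nat_def] s2)
    have p5: "sum ?F (P 5) = sum ?F (P 4)"
      by (rule sum.reindex_bij_witness[of _ "\<lambda>(i,j,k). (j,i,k)" "\<lambda>(i,j,k). (j,i,k)"]) (auto simp: Pm Pm(2)[unfolded One_nat_def] s1)
    show "sum ?F (P m) = sum ?F index_triples"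
      using \<open>m = 0 \<or> _\<close> p1 p2 p3 p4 p5 P0 by auto
  qed
  also have "\<dots> = 6 *\<^sub>R sum ?F index_triples"
    unfolding sum_constant_scaleR by simp
  finally have "sum ?F ?A = 6 *\<^sub>R sum ?F index_triples" .
  moreover have "sum ?F ?A = (\<Sum>i\<in>{1..8}. \<Sum>j\<in>{1..8}. \<Sum>k\<in>{1..8}. F i j k)"
    by (simp add: sum.cartesian_product)
  moreover have "sum ?F index_triples = (1 / 6) *\<^sub>R (6 *\<^sub>R sum ?F index_triples)"
    by simp
  ultimately show ?thesis by (simp only:)
qed

lemma frame_contraction3:
  fixes e f :: "nat \<Rightarrow> 'v::euclidean_space"
    and T :: "'v \<Rightarrow> 'v \<Rightarrow> 'v \<Rightarrow> 'v \<Rightarrow> 'v \<Rightarrow> 'v \<Rightarrow> 'w::real_vector"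
  assumes e: "orthonormal_frame e" and f: "orthonormal_frame f" and d: "DIM('v) = 8"
    and b: "\<And>y y' z z'. bilinear (\<lambda>x x'. T x x' y y' z z')"
       "\<And>x x' z z'. bilinear (\<lambda>y y'. T x x' y y' z z')"
       "\<And>x x' y y'. bilinear (\<lambda>z z'. T x x' y y' z z')"
  shows "(\<Sum>i\<in>{1..8}. \<Sum>j\<in>{1..8}. \<Sum>k\<in>{1..8}. T (e i) (e i) (e j) (e j) (e k) (e k)) =
         (\<Sum>i\<in>{1..8}. \<Sum>j\<in>{1..8}. \<Sum>k\<in>{1..8}. T (f i) (f i) (f j) (f j) (f k) (f k))"
proof -
  note c = frame_contraction[OF e f d]
  have "(\<Sum>i\<in>{1..8}. \<Sum>j\<in>{1..8}. \<Sum>k\<in>{1..8}. T (e i) (e i) (e j) (e j) (e k) (e k)) =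
    (\<Sum>i\<in>{1..8}. \<Sum>j\<in>{1..8}. \<Sum>k\<in>{1..8}. T (e i) (e i) (e j) (e j) (f k) (f k))"
    by (intro sum.cong refl c b)
  also have "\<dots> = (\<Sum>i\<in>{1..8}. \<Sum>k\<in>{1..8}. \<Sum>j\<in>{1..8}. T (e i) (e i) (e j) (e j) (f k) (f k))"
    by (intro sum.cong refl sum.swap)
  also have "\<dots> = (\<Sum>i\<in>{1..8}. \<Sum>k\<in>{1..8}. \<Sum>j\<in>{1..8}. T (e i) (e i) (f j) (f j) (f k) (f k))"
    by (intro sum.cong refl c b)
  also have "\<dots> = (\<Sum>k\<in>{1..8}. \<Sum>j\<in>{1..8}. \<Sum>i\<in>{1..8}. T (e i) (e i) (f j) (f j) (f k) (f k))"
    by (subst sum.swap, intro sum.cong refl sum.swap)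
  also have "\<dots> = (\<Sum>k\<in>{1..8}. \<Sum>j\<in>{1..8}. \<Sum>i\<in>{1..8}. T (f i) (f i) (f j) (f j) (f k) (f k))"
    by (intro sum.cong refl c b)
  also have "\<dots> = (\<Sum>k\<in>{1..8}. \<Sum>i\<in>{1..8}. \<Sum>j\<in>{1..8}. T (f i) (f i) (f j) (f j) (f k) (f k))"
    by (intro sum.cong refl sum.swap)
  also have "\<dots> = (\<Sum>i\<in>{1..8}. \<Sum>k\<in>{1..8}. \<Sum>j\<in>{1..8}. T (f i) (f i) (f j) (f j) (f k) (f k))"
    by (rule sum.swap)
  also have "\<dots> = (\<Sum>i\<in>{1..8}. \<Sum>j\<in>{1..8}. \<Sum>k\<in>{1..8}. T (f i) (f i) (f j) (f j) (f k) (f k))"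
    by (intro sum.cong refl sum.swap)
  finally show ?thesis .
qed

lemma three_form_swap:
  assumes "three_form \<rho>"
  shows "\<rho> y x z = - \<rho> x y z" "\<rho> x z y = - \<rho> x y z"
proof -
  have l: "\<rho> (a + b) c d = \<rho> a c d + \<rho> b c d" "\<rho> c (a + b) d = \<rho> c a d + \<rho> c b d"
     "\<rho> c d (a + b) = \<rho> c d a + \<rho> c d b" for a b c d
    using assms by (auto simp: three_form_def linear_iff)
  have z: "\<rho> a a c = 0" "\<rho> c a a = 0" for a c using assms by (auto simp: three_form_def)
  have "\<rho> (x + y) (x + y) z = \<rho> x x z + \<rho> y x z + (\<rho> x y z + \<rho> y y z)"
    "\<rho> x (y + z) (y + z) = \<rho> x y y + \<rho> x z y + (\<rho> x y z + \<rho> x z z)"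
    by (simp_all add: l)
  then show "\<rho> y x z = - \<rho> x y z" "\<rho> x z y = - \<rho> x y z" by (simp_all add: z)
qed

theorem form_norm_frame_indep:
  fixes e f :: "nat \<Rightarrow> 'v::euclidean_space"
  assumes d: "DIM('v) = 8" and e: "orthonormal_frame e" and f: "orthonormal_frame f"
    and r: "three_form \<rho>"
  shows "form_norm e \<rho> = form_norm f \<rho>"
proof -
  have l: "linear (\<lambda>x. \<rho> x y z)" "linear (\<lambda>y. \<rho> x y z)" "linear (\<lambda>z. \<rho> x y z)" for x y z
    using r by (auto simp: three_form_def)
  have z: "\<rho> a a c = 0" for a c using r by (auto simp: three_form_def)
  have "(\<Sum>(i, j, k)\<in>index_triples. (\<rho> (g i) (g j) (g k))\<^sup>2) =
      (1 / 6) *\<^sub>R (\<Sum>i\<in>{1..8}. \<Sum>j\<in>{1..8}. \<Sum>k\<in>{1..8}. (\<rho> (g i) (g j) (g k))\<^sup>2)" for g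
    by (rule sum_index_triples)
      (auto simp: z power2_eq_iff intro: three_form_swap[OF r])
  moreover have "(\<Sum>i\<in>{1..8}. \<Sum>j\<in>{1..8}. \<Sum>k\<in>{1..8}. (\<rho> (e i) (e j) (e k))\<^sup>2) =
     (\<Sum>i\<in>{1..8}. \<Sum>j\<in>{1..8}. \<Sum>k\<in>{1..8}. (\<rho> (f i) (f j) (f k))\<^sup>2)"
    unfolding power2_eq_square
    by (rule frame_contraction3[OF e f d, where T = "\<lambda>x x' y y' z z'. \<rho> x y z * \<rho> x' y' z'"])
      (use l in \<open>auto simp: bilinear_def linear_iff algebra_simps\<close>)
  ultimately show ?thesis by (simp only: form_norm_def)
qed

lemma clifford_anticommute:
  assumes "spinor_module cl" and "x \<bullet> y = 0"
  shows "cl x (cl y s) = - cl y (cl x s)"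
proof -
  have b: "bilinear cl" and q: "\<And>v s. cl v (cl v s) = - (v \<bullet> v) *\<^sub>R s"
    using assms by (auto simp: spinor_module_def)
  have "cl (x + y) (cl (x + y) s) = - ((x + y) \<bullet> (x + y)) *\<^sub>R s" by (rule q)
  moreover have "cl (x + y) (cl (x + y) s) =
      cl x (cl x s) + cl y (cl x s) + (cl x (cl y s) + cl y (cl y s))"
    by (simp add: bilinear_ladd[OF b] bilinear_radd[OF b])
  moreover have "(x + y) \<bullet> (x + y) = x \<bullet> x + y \<bullet> y"
    using assms(2) by (simp add: inner_add_left inner_add_right inner_commute)
  ultimately have "cl y (cl x s) + cl x (cl y s) = 0"
    unfolding q using assms(2) by (simp add: inner_commute[of y x] algebra_simps)
  then show ?thesis by (simp add: eq_neg_iff_add_eq_0 add.commute)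
qed

theorem clifford_form_frame_indep:
  fixes e f :: "nat \<Rightarrow> 'v::euclidean_space"
  assumes d: "DIM('v) = 8" and e: "orthonormal_frame e" and f: "orthonormal_frame f"
    and S: "spinor_module cl" and r: "three_form \<rho>"
  shows "clifford_form cl e \<rho> = clifford_form cl f \<rho>"
proof
  fix s
  have l: "linear (\<lambda>x. \<rho> x y z)" "linear (\<lambda>y. \<rho> x y z)" "linear (\<lambda>z. \<rho> x y z)" for x y z
    using r by (auto simp: three_form_def)
  have b: "bilinear cl" using S by (auto simp: spinor_module_def)
  have z: "\<rho> a a c = 0" "\<rho> c a a = 0" for a c using r by (auto simp: three_form_def)
  let ?G = "\<lambda>x y z. \<rho> x y z *\<^sub>R cl x (cl y (cl z s))"
  have *: "(\<Sum>(i, j, k)\<in>index_triples. ?G (g i) (g j) (g k)) =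
      (1 / 6) *\<^sub>R (\<Sum>i\<in>{1..8}. \<Sum>j\<in>{1..8}. \<Sum>k\<in>{1..8}. ?G (g i) (g j) (g k))"
    if g: "orthonormal_frame g" for g
  proof (rule sum_index_triples)
    have g0: "g i = g j \<or> g i \<bullet> g j = 0" if "i \<in> {1..8}" "j \<in> {1..8}" for i j
      using g that by (cases "i = j") (auto simp: orthonormal_frame_def)
    fix i j k :: nat assume i: "i \<in> {1..8}" "j \<in> {1..8}" "k \<in> {1..8}"
    show "?G (g j) (g i) (g k) = ?G (g i) (g j) (g k)"
      using g0[OF i(1,2)] z clifford_anticommute[OF S, of "g i" "g j"] three_form_swap(1)[OF r, of "g j" "g i"]
      by auto
    show "?G (g i) (g k) (g j) = ?G (g i) (g j) (g k)"
      using g0[OF i(2,3)] z clifford_anticommute[OF S, of "g j" "g k"] three_form_swap(2)[OF r, of "g i" "g k" "g j"]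
      by (auto simp: bilinear_rneg[OF b])
  qed (simp add: z)
  have "(\<Sum>i\<in>{1..8}. \<Sum>j\<in>{1..8}. \<Sum>k\<in>{1..8}. ?G (e i) (e j) (e k)) =
     (\<Sum>i\<in>{1..8}. \<Sum>j\<in>{1..8}. \<Sum>k\<in>{1..8}. ?G (f i) (f j) (f k))"
    by (rule frame_contraction3[OF e f d, where T = "\<lambda>x x' y y' z z'. \<rho> x y z *\<^sub>R cl x' (cl y' (cl z' s))"])
      (use l b in \<open>auto simp: bilinear_def linear_iff algebra_simps\<close>)
  then show "clifford_form cl e \<rho> s = clifford_form cl f \<rho> s"
    by (simp add: clifford_form_def *[OF e] *[OF f])
qed

lemma clifford_skew:
  assumes S: "spinor_module cl"
  shows "cl v s \<bullet> t = - (s \<bullet> cl v t)"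
proof (cases "v = 0")
  case True
  then show ?thesis using S by (simp add: spinor_module_def bilinear_lzero)
next
  case False
  have b: "bilinear cl" using S by (simp add: spinor_module_def)
  let ?u = "v /\<^sub>R norm v"
  have "cl ?u s \<bullet> cl ?u (cl v t) = s \<bullet> cl v t"
    using S False by (simp add: spinor_module_def)
  then have "(inverse (norm v))\<^sup>2 * (cl v s \<bullet> cl v (cl v t)) = s \<bullet> cl v t"
    by (simp add: bilinear_lmul[OF b] power2_eq_square)
  moreover have "cl v (cl v t) = - (norm v)\<^sup>2 *\<^sub>R t"
    using S by (simp add: spinor_module_def power2_norm_eq_inner)
  ultimately show ?thesis using False by (simp add: field_simps)
qed

lemma isometric_forms_iff:
  fixes e :: "nat \<Rightarrow> 'v::euclidean_space"
  assumes e: "orthonormal_frame e" and S: "spinor_module cl"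
  shows "\<rho> \<in> isometric_forms cl e \<longleftrightarrow>
    three_form \<rho> \<and> (\<forall>s. clifford_form cl e \<rho> (clifford_form cl e \<rho> s) = s)"
proof -
  let ?A = "clifford_form cl e \<rho>" and ?w = "clifford_volume cl e"
  have b: "bilinear cl" using S by (simp add: spinor_module_def)
  have lin: "linear (cl v)" for v using b by (simp add: bilinear_def)
  have neg: "cl v (- s) = - cl v s" for v s by (rule bilinear_rneg[OF b])
  have ac: "cl (e i) (cl (e j) s) = - cl (e j) (cl (e i) s)"
    if "i \<noteq> j" "i \<in> {1..8}" "j \<in> {1..8}" for i j s
  proof (rule clifford_anticommute[OF S])
    show "e i \<bullet> e j = 0" using e that by (simp add: orthonormal_frame_def)
  qed
  have ord: "cl (e j) (cl (e i) s) = - cl (e i) (cl (e j) s)"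
    if "i < j" "1 \<le> i" "j \<le> 8" for i j s
    using ac[of j i s] that by auto
  have sq: "cl (e i) (cl (e i) s) = - s" if "1 \<le> i" "i \<le> 8" for i s
    using S e that by (auto simp: spinor_module_def orthonormal_frame_def)
  have wl: "linear ?w"
    unfolding clifford_volume_def using lin by (auto simp: linear_iff)
  have ww: "?w (?w s) = s" for s
    unfolding clifford_volume_def by (simp add: ord sq neg)
  have wc: "?w (cl (e m) s) = - cl (e m) (?w s)" if "m \<in> {1..8}" for m s
  proof -
    have "m = 1 \<or> m = 2 \<or> m = 3 \<or> m = 4 \<or> m = 5 \<or> m = 6 \<or> m = 7 \<or> m = 8" using that by auto
    then show ?thesis unfolding clifford_volume_def by (elim disjE) (simp_all add: ord sq neg)
  qed
  have Al: "linear ?A"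
    by (auto simp: linear_iff clifford_form_def linear_add[OF lin] linear_scale[OF lin] sum.distrib
        algebra_simps scaleR_sum_right split_def)
  have wA: "?w (?A s) = - ?A (?w s)" for s
    unfolding clifford_form_def linear_sum[OF wl] sum_negf[symmetric]
    by (rule sum.cong) (auto simp: index_triples_def linear_scale[OF wl] wc neg)
  have sym: "?A s \<bullet> t = s \<bullet> ?A t" for s t
    unfolding clifford_form_def inner_sum_left inner_sum_right
  proof (rule sum.cong[OF refl], safe)
    fix i j k assume "(i, j, k) \<in> index_triples"
    then have i: "i \<noteq> j" "j \<noteq> k" "i \<noteq> k" "i \<in> {1..8}" "j \<in> {1..8}" "k \<in> {1..8}"
      by (auto simp: index_triples_def)
    have "cl (e i) (cl (e j) (cl (e k) s)) \<bullet> t = - (s \<bullet> cl (e k) (cl (e j) (cl (e i) t)))"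
      by (simp add: clifford_skew[OF S])
    also have "cl (e k) (cl (e j) (cl (e i) t)) = - cl (e i) (cl (e j) (cl (e k) t))"
      using i by (metis ac neg)
    finally show "\<rho> (e i) (e j) (e k) *\<^sub>R cl (e i) (cl (e j) (cl (e k) s)) \<bullet> t =
       s \<bullet> \<rho> (e i) (e j) (e k) *\<^sub>R cl (e i) (cl (e j) (cl (e k) t))" by simp
  qed
  have "isometry_onto ?A (half_spin_plus cl e) (half_spin_minus cl e) \<longleftrightarrow> (\<forall>s. ?A (?A s) = s)"
  proof
    assume I: "isometry_onto ?A (half_spin_plus cl e) (half_spin_minus cl e)"
    have P: "?A (?A s) = s" if s: "?w s = s" for s
    proof -
      let ?r = "?A (?A s) - s"
      have "?w ?r = ?r" using s by (simp add: linear_diff[OF wl] wA linear_neg[OF Al])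
      moreover have "?A s \<bullet> ?A ?r = s \<bullet> ?r"
        using I s \<open>?w ?r = ?r\<close> by (auto simp: isometry_onto_def half_spin_plus_def)
      ultimately have "?r \<bullet> ?r = 0" by (simp add: sym[symmetric] inner_diff_left)
      then show ?thesis by simp
    qed
    have M: "?A (?A s) = s" if s: "?w s = - s" for s
    proof -
      have "s \<in> ?A ` half_spin_plus cl e"
        using I s by (auto simp: isometry_onto_def half_spin_minus_def)
      then obtain t where "s = ?A t" "?w t = t" by (auto simp: half_spin_plus_def)
      then show ?thesis using P by simp
    qed
    show "\<forall>s. ?A (?A s) = s"
    proof
      fix s
      have "?w (s + ?w s) = s + ?w s" "?w (s - ?w s) = - (s - ?w s)"
        by (simp_all add: linear_add[OF wl] linear_diff[OF wl] ww)
      then have "?A (?A (s + ?w s)) = s + ?w s" "?A (?A (s - ?w s)) = s - ?w s"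
        using P M by blast+
      then have "?A (?A (s + ?w s)) + ?A (?A (s - ?w s)) = 2 *\<^sub>R s" by (simp add: scaleR_2)
      then have "2 *\<^sub>R ?A (?A s) = 2 *\<^sub>R s"
        by (simp add: linear_add[OF Al] linear_diff[OF Al] scaleR_2)
      then show "?A (?A s) = s" by simp
    qed
  next
    assume A: "\<forall>s. ?A (?A s) = s"
    have "?A s \<bullet> ?A t = s \<bullet> t" for s t using A by (simp add: sym)
    moreover have "?A ` half_spin_plus cl e = half_spin_minus cl e"
    proof safe
      fix s assume "s \<in> half_spin_plus cl e"
      then show "?A s \<in> half_spin_minus cl e" by (simp add: half_spin_plus_def half_spin_minus_def wA)
    next
      fix s assume "s \<in> half_spin_minus cl e"
      then have "?A s \<in> half_spin_plus cl e"
        by (simp add: half_spin_plus_def half_spin_minus_def wA linear_neg[OF Al])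
      then show "s \<in> ?A ` half_spin_plus cl e" using A by (metis imageI)
    qed
    ultimately show "isometry_onto ?A (half_spin_plus cl e) (half_spin_minus cl e)"
      by (simp add: isometry_onto_def)
  qed
  then show ?thesis by (auto simp: isometric_forms_def)
qed

theorem isometric_forms_frame_indep:
  fixes e f :: "nat \<Rightarrow> 'v::euclidean_space"
  assumes "DIM('v) = 8" and "orthonormal_frame e" and "orthonormal_frame f" and "spinor_module cl"
  shows "isometric_forms cl e = isometric_forms cl f"
  using assms clifford_form_frame_indep[OF assms] by (auto simp: isometric_forms_iff)

end

(*
  Let A be the Clifford action of the 3-form rho, [x,y] the bracket dual to rho, and
  B_x = sum_ij rho(e_i,e_j,x) e_i e_j. The Clifford relations give
    x A + A x = - B_x,   [B_x, v] = 4 [x,v],   [B_x, A] = - 4 D_x,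
  where D_x is the Clifford action of the infinitesimal change of rho under ad x. As ad x is skew,
  this change is the contraction of the Jacobiator of the bracket with the metric.
  If A^2 = 1, the first relation shows that A commutes with every B_x, so D_x = 0. By the first two
  relations a 3-form acting as zero vanishes; hence the Jacobi identity holds.
  Conversely, under the Jacobi identity A commutes with every B_x, and 6 A = sum_k B_k e_k together
  with the first relation gives 12 A^2 = - sum_k B_k^2. Reordering the Clifford products in the
  cyclic sum of the Jacobi identity evaluates this to 12 |rho|^2. So A^2 = |rho|^2, which yields
  part (b) and, by comparison with A^2 = 1, the unit length in part (a).
  The adjoint group preserves the metric if and only if every ad x is skew, as one sees by
  differentiating <exp(t ad x) y, exp(t ad x) z>.
*)
theory Submission
  imports Defs
begin

section \<open>One-parameter groups\<close>

text \<open>The orbit of \<open>y\<close> under exp(tD), with \<open>t\<close> kept apart from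
  \<open>D\<close>: for fixed \<open>y\<close> its components are real power series in
  \<open>t\<close> and can be differentiated term by term.\<close>

definition exp_flow :: "('v::euclidean_space \<Rightarrow> 'v) \<Rightarrow> real \<Rightarrow> 'v \<Rightarrow> 'v" where
  "exp_flow D t y = (\<Sum>n. (t ^ n / fact n) *\<^sub>R (D ^^ n) y)"

lemma linear_funpow:
  fixes D :: "'v::real_vector \<Rightarrow> 'v"
  assumes "linear D"
  shows "linear (D ^^ n)"
  by (induction n) (use assms in \<open>auto simp: linear_iff\<close>)

lemma norm_funpow_le:
  fixes D :: "'v::euclidean_space \<Rightarrow> 'v"
  assumes "linear D"
  shows "norm ((D ^^ n) y) \<le> onorm D ^ n * norm y"
proof (induction n)
  case (Suc n)
  have "norm (D ((D ^^ n) y)) \<le> onorm D * norm ((D ^^ n) y)"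
    using assms by (simp add: onorm linear_linear)
  also have "\<dots> \<le> onorm D * (onorm D ^ n * norm y)"
    using Suc assms by (intro mult_left_mono) (auto simp: onorm_pos_le linear_linear)
  finally show ?case by (simp add: mult_ac)
qed simp

lemma summable_exp_flow:
  fixes D :: "'v::euclidean_space \<Rightarrow> 'v"
  assumes "linear D"
  shows "summable (\<lambda>n. (t ^ n / fact n) *\<^sub>R (D ^^ n) y)"
proof (rule summable_comparison_test)
  show "summable (\<lambda>n. (\<bar>t\<bar> * onorm D) ^ n /\<^sub>R fact n * norm y)"
    by (rule summable_mult2[OF summable_exp_generic])
  have "norm ((t ^ n / fact n) *\<^sub>R (D ^^ n) y) \<le> (\<bar>t\<bar> * onorm D) ^ n /\<^sub>R fact n * norm y" for n
  proof -
    have "norm ((t ^ n / fact n) *\<^sub>R (D ^^ n) y) = \<bar>t\<bar> ^ n / fact n * norm ((D ^^ n) y)"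
      by (simp add: power_abs)
    also have "\<dots> \<le> \<bar>t\<bar> ^ n / fact n * (onorm D ^ n * norm y)"
      by (intro mult_left_mono norm_funpow_le[OF assms]) simp
    finally show ?thesis by (simp add: power_mult_distrib field_simps)
  qed
  then show "\<exists>N. \<forall>n\<ge>N. norm ((t ^ n / fact n) *\<^sub>R (D ^^ n) y)
      \<le> (\<bar>t\<bar> * onorm D) ^ n /\<^sub>R fact n * norm y" by blast
qed

lemma exp_flow_0 [simp]: "exp_flow D 0 y = y"
proof -
  have "exp_flow D 0 y = (\<Sum>n. if n = 0 then y else 0)"
    unfolding exp_flow_def by (intro suminf_cong) simp
  then show ?thesis using suminf_finite[of "{0::nat}" "\<lambda>n. if n = 0 then y else 0"] by simp
qed

lemma linear_exp_flow:
  assumes "linear D"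
  shows "linear (exp_flow D t)"
proof -
  note s = summable_exp_flow[OF assms] and l = linear_funpow[OF assms]
  show ?thesis
  proof (rule linearI)
    show "exp_flow D t (x + y) = exp_flow D t x + exp_flow D t y" for x y
      unfolding exp_flow_def by (simp add: suminf_add[OF s s] linear_add[OF l] scaleR_add_right)
    show "exp_flow D t (c *\<^sub>R x) = c *\<^sub>R exp_flow D t x" for c x
      unfolding exp_flow_def suminf_scaleR_right[OF s] by (simp add: linear_scale[OF l] mult_ac)
  qed
qed

lemma exp_flow_commute:
  assumes "linear D"
  shows "D (exp_flow D t y) = exp_flow D t (D y)"
proof -
  have b: "bounded_linear D" using assms by (simp add: linear_linear)
  show ?thesis
    unfolding exp_flow_def bounded_linear.suminf[OF b summable_exp_flow[OF assms]]
    by (simp add: linear_scale[OF assms] funpow_swap1)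
qed

text \<open>Pairing with \<open>b\<close> yields a real power series that converges everywhere.
  Formal differentiation lowers the factorial by one and leaves one extra \<open>D\<close> on
  \<open>y\<close>, which gives the series started at \<open>D y\<close>.\<close>

lemma exp_flow_component_deriv:
  assumes "linear D"
  shows "((\<lambda>t. exp_flow D t y \<bullet> b) has_field_derivative exp_flow D t (D y) \<bullet> b) (at t)"
proof -
  define c where "c = (\<lambda>n. ((D ^^ n) y \<bullet> b) / fact n)"
  note bl = bounded_linear_inner_left[of b]
  have ser: "exp_flow D t z \<bullet> b = (\<Sum>n. ((D ^^ n) z \<bullet> b) / fact n * t ^ n)" for t z
    unfolding exp_flow_def bounded_linear.suminf[OF bl summable_exp_flow[OF assms]]
    by (simp add: mult_ac)
  have "summable (\<lambda>n. c n * t ^ n)" for t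
    using bounded_linear.summable[OF bl summable_exp_flow[OF assms, of t y]]
    by (simp add: c_def mult_ac)
  then have "((\<lambda>t. \<Sum>n. c n * t ^ n) has_field_derivative (\<Sum>n. diffs c n * t ^ n)) (at t)"
    by (rule termdiffs_strong_converges_everywhere)
  moreover have "diffs c n = ((D ^^ n) (D y) \<bullet> b) / fact n" for n
    by (simp add: diffs_def c_def funpow_swap1 divide_simps)
  ultimately show ?thesis by (simp add: ser c_def)
qed

lemma exp_flow_inner_deriv:
  assumes "linear D"
  shows "((\<lambda>t. exp_flow D t y \<bullet> exp_flow D t z) has_field_derivative
    exp_flow D t (D y) \<bullet> exp_flow D t z + exp_flow D t y \<bullet> exp_flow D t (D z)) (at t)"
  unfolding euclidean_inner[of "exp_flow D _ _" "exp_flow D _ _"] sum.distrib[symmetric]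
  by (rule DERIV_sum) (auto intro!: derivative_eq_intros exp_flow_component_deriv[OF assms])

text \<open>\<open>D\<close> commutes with its flow, so by skewness the two terms of the product
  rule cancel; the inner product is constant in \<open>t\<close> and equals its value at 0.\<close>

lemma exp_flow_preserves_inner:
  assumes "linear D" and skew: "\<And>y z. D y \<bullet> z = - (y \<bullet> D z)"
  shows "exp_flow D t y \<bullet> exp_flow D t z = y \<bullet> z"
proof -
  have "((\<lambda>t. exp_flow D t y \<bullet> exp_flow D t z) has_field_derivative 0) (at t)" for t
    using exp_flow_inner_deriv[OF assms(1), of y z t]
    by (simp add: exp_flow_commute[OF assms(1), symmetric] skew)
  from DERIV_isconst_all[of "\<lambda>t. exp_flow D t y \<bullet> exp_flow D t z" t 0] this
  show ?thesis by simp
qed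

lemma skew_if_exp_flow_preserves_inner:
  assumes "linear D" and "\<And>t y z. exp_flow D t y \<bullet> exp_flow D t z = y \<bullet> z"
  shows "D y \<bullet> z = - (y \<bullet> D z)"
  using DERIV_unique[OF exp_flow_inner_deriv[OF assms(1), of y z 0]] assms(2)
  by (simp add: eq_neg_iff_add_eq_0)

section \<open>Isometry of the adjoint group and skewness of ad\<close>

lemma exp_ad_scaleR:
  assumes "bilinear br"
  shows "exp_ad br (t *\<^sub>R x) = exp_flow (br x) t"
proof
  fix y
  have l: "linear (br x)" using assms by (simp add: bilinear_def)
  have "(br (t *\<^sub>R x) ^^ n) y = t ^ n *\<^sub>R (br x ^^ n) y" for n
    by (induction n) (simp_all add: bilinear_lmul[OF assms] linear_scale[OF l] mult_ac)
  then show "exp_ad br (t *\<^sub>R x) y = exp_flow (br x) t y"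
    by (simp add: exp_ad_def exp_flow_def)
qed

lemma adjoint_group_orthogonal:
  assumes br: "bilinear br" and skew: "\<And>x y z. br x y \<bullet> z = - (y \<bullet> br x z)"
    and "\<phi> \<in> adjoint_group br"
  shows "orthogonal_transformation \<phi>"
  using assms(3)
proof induction
  case (exp x)
  have l: "linear (br x)" using br by (simp add: bilinear_def)
  show ?case
    using exp_ad_scaleR[OF br, of 1 x] linear_exp_flow[OF l] exp_flow_preserves_inner[OF l skew]
    by (simp add: orthogonal_transformation_def)
qed (auto simp: id_def o_def orthogonal_transformation_compose[unfolded o_def] orthogonal_transformation_inv)

text \<open>exp(t ad x) = exp(ad (t x)) belongs to the adjoint group for every \<open>t\<close>, so
  a whole one-parameter group of isometries is available for differentiation at 0.\<close>

lemma skew_if_adjoint_group_isometric: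
  assumes br: "bilinear br"
    and "\<And>\<phi> x y. \<phi> \<in> adjoint_group br \<Longrightarrow> \<phi> x \<bullet> \<phi> y = x \<bullet> y"
  shows "br x y \<bullet> z = - (y \<bullet> br x z)"
proof (rule skew_if_exp_flow_preserves_inner)
  show "linear (br x)" using br by (simp add: bilinear_def)
  show "exp_flow (br x) t y \<bullet> exp_flow (br x) t z = y \<bullet> z" for t y z
    using assms(2)[OF adjoint_group.exp] by (simp flip: exp_ad_scaleR[OF br])
qed

section \<open>The Clifford square of a 3-form\<close>

(* Otherwise simp turns the index range {1..8} into {Suc 0..8}, and facts about it no longer match. *)
declare One_nat_def [simp del]

lemma scaleR_3_6:
  fixes x :: "'w::real_vector"
  shows "3 *\<^sub>R x = x + x + x" and "6 *\<^sub>R x = 2 *\<^sub>R x + 2 *\<^sub>R x + 2 *\<^sub>R x"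
  using scaleR_left_distrib[of 2 1 x] scaleR_left_distrib[of 2 2 x] scaleR_left_distrib[of 4 2 x]
  by (simp_all add: scaleR_2)

text \<open>Solves the equation that arises when anticommutation reproduces a quantity with the
  opposite sign, up to a correction.\<close>

lemma eq_uminus_if_twice:
  fixes x y :: "'w::real_vector"
  assumes "x = - x - 2 *\<^sub>R y"
  shows "x = - y"
proof -
  have "2 *\<^sub>R (x + y) = x - (- x - 2 *\<^sub>R y)" by (simp add: scaleR_2 algebra_simps)
  also have "\<dots> = 0" using assms by (simp only: right_minus_eq)
  finally show ?thesis by (simp add: eq_neg_iff_add_eq_0)
qed

section \<open>Clifford relations for arbitrary vectors\<close>

locale spin_frame =
  fixes e :: "nat \<Rightarrow> 'v::euclidean_space" and cl :: "'v \<Rightarrow> 's::euclidean_space \<Rightarrow> 's"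
  assumes dim: "DIM('v) = 8" and frame: "orthonormal_frame e" and module: "spinor_module cl"
begin

abbreviation I :: "nat set" where "I \<equiv> {1..8}"

lemma bil: "bilinear cl" using module by (simp add: spinor_module_def)

lemma cl_linear: "linear (cl v)" "linear (\<lambda>v. cl v s)"
  using bil by (auto simp: bilinear_def)

lemmas cl_simps = bilinear_ladd[OF bil] bilinear_radd[OF bil] bilinear_lmul[OF bil]
  bilinear_rmul[OF bil] bilinear_lneg[OF bil] bilinear_rneg[OF bil] bilinear_lsub[OF bil]
  bilinear_rsub[OF bil] bilinear_lzero[OF bil] bilinear_rzero[OF bil]

lemma cl_sum: "cl v (sum f T) = (\<Sum>x\<in>T. cl v (f x))" "cl (sum g T) s = (\<Sum>x\<in>T. cl (g x) s)"
  by (simp_all add: linear_sum[OF cl_linear(1)] linear_sum[OF cl_linear(2)])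

lemma cl_square: "cl v (cl v s) = - (v \<bullet> v) *\<^sub>R s"
  using module by (simp add: spinor_module_def)

text \<open>Polarisation of v v = -g(v,v). Unlike \<open>clifford_anticommute\<close> it keeps the
  scalar term, since brackets of frame vectors need not be orthogonal to the frame vectors they
  multiply.\<close>

lemma cl_swap: "cl u (cl v s) = - cl v (cl u s) - (2 * (u \<bullet> v)) *\<^sub>R s"
proof -
  have "cl (u + v) (cl (u + v) s) = - ((u + v) \<bullet> (u + v)) *\<^sub>R s" by (rule cl_square)
  then have "cl u (cl v s) + cl v (cl u s) = - (2 * (u \<bullet> v)) *\<^sub>R s"
    by (simp add: cl_simps cl_square inner_add_left inner_add_right inner_commute[of v u]
        algebra_simps eq_neg_iff_add_eq_0)
  then show ?thesis
    by (metis add_diff_cancel_left' minus_diff_eq diff_minus_eq_add scaleR_minus_left uminus_add_conv_diff)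
qed

lemma cl_eq_0_imp: assumes "\<And>s. cl v s = 0" shows "v = 0"
proof -
  obtain s :: 's where "s \<in> Basis" by (meson nonempty_Basis ex_in_conv)
  then have "s \<noteq> 0" by auto
  moreover have "(v \<bullet> v) *\<^sub>R s = 0" using cl_square[of v s] by (simp add: assms)
  ultimately show ?thesis by simp
qed

section \<open>Contractions over the orthonormal frame\<close>

lemma expansion: "(\<Sum>i\<in>I. (x \<bullet> e i) *\<^sub>R e i) = x"
  using orthonormal_frame_expansion[OF frame dim, of x] by simp

lemma contract:
  assumes "linear f"
  shows "(\<Sum>i\<in>I. (x \<bullet> e i) *\<^sub>R f (e i)) = f x"
proof -
  have "f (\<Sum>i\<in>I. (x \<bullet> e i) *\<^sub>R e i) = (\<Sum>i\<in>I. (x \<bullet> e i) *\<^sub>R f (e i))"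
    by (simp add: linear_sum[OF assms] linear_scale[OF assms])
  then show ?thesis by (simp add: expansion)
qed

lemma contract_form:
  fixes w :: "'w::real_vector"
  assumes "linear g"
  shows "(\<Sum>i\<in>I. ((x \<bullet> e i) * g (e i)) *\<^sub>R w) = g x *\<^sub>R w"
  unfolding contract[OF assms, of x, symmetric] by (simp add: scaleR_sum_left)

text \<open>In the frame a skew \<open>M\<close> has an antisymmetric matrix. Exchanging the two
  summation indices therefore moves \<open>M\<close> from one factor to the other at the cost of a
  sign.\<close>

lemma contract_skew:
  assumes f: "linear f" and g: "linear g" and M: "\<And>u v. M u \<bullet> v = - (u \<bullet> M v)"
  shows "(\<Sum>i\<in>I. g (e i) *\<^sub>R f (M (e i))) = - (\<Sum>i\<in>I. g (M (e i)) *\<^sub>R f (e i))"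
proof -
  have "(\<Sum>i\<in>I. g (e i) *\<^sub>R f (M (e i))) =
      (\<Sum>i\<in>I. \<Sum>l\<in>I. ((M (e i) \<bullet> e l) * g (e i)) *\<^sub>R f (e l))"
    by (subst contract[OF f, symmetric]) (simp add: scaleR_sum_right mult_ac)
  also have "\<dots> = (\<Sum>l\<in>I. \<Sum>i\<in>I. ((M (e i) \<bullet> e l) * g (e i)) *\<^sub>R f (e l))"
    by (rule sum.swap)
  also have "\<dots> = (\<Sum>l\<in>I. - (\<Sum>i\<in>I. ((M (e l) \<bullet> e i) * g (e i)) *\<^sub>R f (e l)))"
  proof (intro sum.cong refl)
    fix l
    have "M (e i) \<bullet> e l = - (M (e l) \<bullet> e i)" for i using M by (metis inner_commute)
    then show "(\<Sum>i\<in>I. ((M (e i) \<bullet> e l) * g (e i)) *\<^sub>R f (e l)) =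
        - (\<Sum>i\<in>I. ((M (e l) \<bullet> e i) * g (e i)) *\<^sub>R f (e l))"
      by (simp only: mult_minus_left scaleR_minus_left sum_negf)
  qed
  finally show ?thesis by (simp only: contract_form[OF g] sum_negf)
qed

lemma sum_rotate:
  fixes F :: "nat \<Rightarrow> nat \<Rightarrow> nat \<Rightarrow> 'w::real_vector"
  shows "(\<Sum>i\<in>I. \<Sum>j\<in>I. \<Sum>k\<in>I. F i j k) = (\<Sum>j\<in>I. \<Sum>k\<in>I. \<Sum>i\<in>I. F i j k)"
  by (subst sum.swap) (intro sum.cong refl sum.swap)

text \<open>The matrix of \<open>K\<close> is symmetric while distinct frame vectors anticommute, so
  the off-diagonal terms cancel and only the trace survives. The sign is that of e_i e_i =
  -1.\<close>

lemma contract_selfadjoint: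
  assumes K: "linear K" and sa: "\<And>u v. K u \<bullet> v = u \<bullet> K v"
  shows "(\<Sum>i\<in>I. cl (e i) (cl (K (e i)) s)) = - (\<Sum>i\<in>I. e i \<bullet> K (e i)) *\<^sub>R s"
proof -
  let ?X = "\<Sum>i\<in>I. cl (e i) (cl (K (e i)) s)"
  have "?X = (\<Sum>i\<in>I. \<Sum>j\<in>I. (K (e i) \<bullet> e j) *\<^sub>R cl (e i) (cl (e j) s))"
    by (subst contract[symmetric, where f = "\<lambda>v. cl v s"])
      (simp_all add: cl_linear cl_sum cl_simps)
  also have "\<dots> = (\<Sum>j\<in>I. \<Sum>i\<in>I. (K (e i) \<bullet> e j) *\<^sub>R cl (e i) (cl (e j) s))"
    by (rule sum.swap)
  also have "\<dots> = (\<Sum>j\<in>I. \<Sum>i\<in>I. (K (e j) \<bullet> e i) *\<^sub>R cl (e i) (cl (e j) s))"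
  proof (intro sum.cong refl)
    fix i j
    have "K (e i) \<bullet> e j = K (e j) \<bullet> e i" using sa by (metis inner_commute)
    then show "(K (e i) \<bullet> e j) *\<^sub>R cl (e i) (cl (e j) s) = (K (e j) \<bullet> e i) *\<^sub>R cl (e i) (cl (e j) s)"
      by (simp only:)
  qed
  also have "\<dots> = (\<Sum>j\<in>I. cl (K (e j)) (cl (e j) s))"
    by (simp add: contract[where f = "\<lambda>v. cl v _"] cl_linear)
  also have "\<dots> = (\<Sum>j\<in>I. - cl (e j) (cl (K (e j)) s) - (2 * (e j \<bullet> K (e j))) *\<^sub>R s)"
    by (subst cl_swap) (simp add: inner_commute)
  also have "\<dots> = - ?X - 2 *\<^sub>R ((\<Sum>i\<in>I. e i \<bullet> K (e i)) *\<^sub>R s)"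
    by (simp add: sum_subtractf sum_negf scaleR_sum_left scaleR_sum_right)
  finally have "?X = - ((\<Sum>i\<in>I. e i \<bullet> K (e i)) *\<^sub>R s)" by (rule eq_uminus_if_twice)
  then show ?thesis by (simp only: scaleR_minus_left)
qed

lemma frame_anticommute:
  assumes "i \<in> I" "j \<in> I" "i \<noteq> j"
  shows "cl (e i) (cl (e j) s) = - cl (e j) (cl (e i) s)"
  by (rule clifford_anticommute[OF module]) (use frame assms in \<open>simp add: orthonormal_frame_def\<close>)

text \<open>Coefficient and Clifford product both change sign when two distinct indices are
  exchanged, and repeated indices contribute nothing, so each increasing triple is counted 6 times.
  Unrestricted indices are what contraction and relabelling need.\<close>

lemma form_sum:
  assumes r: "three_form \<rho>"
  shows "clifford_form cl e \<rho> s = (1 / 6) *\<^sub>R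
    (\<Sum>i\<in>I. \<Sum>j\<in>I. \<Sum>k\<in>I. \<rho> (e i) (e j) (e k) *\<^sub>R cl (e i) (cl (e j) (cl (e k) s)))"
  unfolding clifford_form_def
proof (rule sum_index_triples)
  fix i j k :: nat assume i: "i \<in> I" "j \<in> I" "k \<in> I"
  show "\<rho> (e j) (e i) (e k) *\<^sub>R cl (e j) (cl (e i) (cl (e k) s)) =
      \<rho> (e i) (e j) (e k) *\<^sub>R cl (e i) (cl (e j) (cl (e k) s))"
    by (cases "i = j")
      (simp_all add: frame_anticommute[OF i(1,2)] three_form_swap(1)[OF r, of "e i" "e j" "e k"])
  show "\<rho> (e i) (e k) (e j) *\<^sub>R cl (e i) (cl (e k) (cl (e j) s)) =
      \<rho> (e i) (e j) (e k) *\<^sub>R cl (e i) (cl (e j) (cl (e k) s))"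
    by (cases "j = k")
      (simp_all add: frame_anticommute[OF i(2,3)] three_form_swap(2)[OF r, of "e i" "e j" "e k"] cl_simps)
next
  fix i k :: nat
  have "\<rho> (e i) (e i) (e k) = 0" using r by (auto simp: three_form_def)
  then show "\<rho> (e i) (e i) (e k) *\<^sub>R cl (e i) (cl (e i) (cl (e k) s)) = 0" by simp
qed

text \<open>The sum runs over ordered pairs, so for a 3-form this is twice the Clifford action of
  the 2-form \<rho>(x, ., .).\<close>

definition contr :: "('v \<Rightarrow> 'v \<Rightarrow> 'v \<Rightarrow> real) \<Rightarrow> 'v \<Rightarrow> 's \<Rightarrow> 's" where
  "contr \<rho> x s = (\<Sum>i\<in>I. \<Sum>j\<in>I. \<rho> (e i) (e j) x *\<^sub>R cl (e i) (cl (e j) s))"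

definition bracket :: "('v \<Rightarrow> 'v \<Rightarrow> 'v \<Rightarrow> real) \<Rightarrow> 'v \<Rightarrow> 'v \<Rightarrow> 'v" where
  "bracket \<rho> x y = (\<Sum>k\<in>I. \<rho> x y (e k) *\<^sub>R e k)"

text \<open>For trilinear \<rho> this is the derivative at t = 0 of the pullback of \<rho> by exp(t
  ad x), with ad taken for \<open>bracket \<rho>\<close>.\<close>

definition variation :: "('v \<Rightarrow> 'v \<Rightarrow> 'v \<Rightarrow> real) \<Rightarrow> 'v \<Rightarrow> 'v \<Rightarrow> 'v \<Rightarrow> 'v \<Rightarrow> real" where
  "variation \<rho> x u v w =
    \<rho> (bracket \<rho> x u) v w + \<rho> u (bracket \<rho> x v) w + \<rho> u v (bracket \<rho> x w)"

lemma clifford_form_linear: "linear (clifford_form cl e \<rho>)"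
  by (rule linearI) (simp_all add: clifford_form_def split_def cl_simps sum.distrib
      scaleR_add_right scaleR_sum_right mult.commute)

lemma contr_linear: "linear (contr \<rho> x)"
  by (rule linearI) (simp_all add: contr_def cl_simps sum.distrib
      scaleR_add_right scaleR_sum_right mult.commute)

end

section \<open>A 3-form and its dual bracket\<close>

locale spin_form = spin_frame e cl
  for e :: "nat \<Rightarrow> 'v::euclidean_space" and cl :: "'v \<Rightarrow> 's::euclidean_space \<Rightarrow> 's" +
  fixes \<rho> :: "'v \<Rightarrow> 'v \<Rightarrow> 'v \<Rightarrow> real"
  assumes form: "three_form \<rho>"
begin

abbreviation A :: "'s \<Rightarrow> 's" where "A \<equiv> clifford_form cl e \<rho>"
abbreviation B :: "'v \<Rightarrow> 's \<Rightarrow> 's" where "B \<equiv> contr \<rho>"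
abbreviation br :: "'v \<Rightarrow> 'v \<Rightarrow> 'v" where "br \<equiv> bracket \<rho>"

lemma lin: "linear (\<lambda>x. \<rho> x y z)" "linear (\<lambda>y. \<rho> x y z)" "linear (\<lambda>z. \<rho> x y z)"
  using form by (auto simp: three_form_def)

lemma form_simps: "\<rho> (a + b) c d = \<rho> a c d + \<rho> b c d" "\<rho> c (a + b) d = \<rho> c a d + \<rho> c b d"
  "\<rho> c d (a + b) = \<rho> c d a + \<rho> c d b"
  "\<rho> (t *\<^sub>R a) c d = t * \<rho> a c d" "\<rho> c (t *\<^sub>R a) d = t * \<rho> c a d" "\<rho> c d (t *\<^sub>R a) = t * \<rho> c d a"
  using linear_add[OF lin(1)] linear_add[OF lin(2)] linear_add[OF lin(3)]
   linear_scale[OF lin(1)] linear_scale[OF lin(2)] linear_scale[OF lin(3)] by auto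

lemma form_diag: "\<rho> a a c = 0" "\<rho> a c a = 0" "\<rho> c a a = 0"
  using form by (auto simp: three_form_def)

lemma form_swap: "\<rho> y x z = - \<rho> x y z" "\<rho> x z y = - \<rho> x y z"
  by (fact three_form_swap[OF form])+

lemma form_cyclic: "\<rho> x y z = \<rho> y z x"
  using form_swap(1)[of x y z] form_swap(2)[of y z x] by simp

lemma br_inner: "br x y \<bullet> z = \<rho> x y z"
proof -
  have "br x y \<bullet> z = (\<Sum>k\<in>I. (z \<bullet> e k) *\<^sub>R \<rho> x y (e k))"
    by (simp add: bracket_def inner_sum_left mult.commute inner_commute[of z])
  then show ?thesis by (simp only: contract[OF lin(3)])
qed

lemma br_bilinear: "bilinear br"
  by (simp add: bilinear_def linear_iff bracket_def form_simps sum.distrib scaleR_add_left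
      scaleR_sum_right)

lemma br_linear: "linear (br x)" "linear (\<lambda>x. br x y)"
  using br_bilinear by (auto simp: bilinear_def)

lemma br_swap: "br y x = - br x y"
  by (simp add: bracket_def form_swap(1)[of y x] sum_negf)

lemma br_diag: "br x x = 0"
  by (simp add: bracket_def form_diag)

lemma br_skew: "br x y \<bullet> z = - (y \<bullet> br x z)"
  by (simp add: br_inner inner_commute[of y] form_swap(2)[of x y z])

text \<open>Equal arguments make two terms cancel and the third vanish. Being a 3-form, the
  variation is itself subject to the results of this locale, notably
  \<open>form_eq_0\<close>.\<close>

lemma variation_form: "three_form (variation \<rho> x)"
proof -
  note b = linear_add[OF br_linear(1)] linear_scale[OF br_linear(1)]
  have swap13: "\<rho> u w p = - \<rho> p w u" for p u w
    using form_cyclic[of u w p] form_swap(1)[of p w u] by simp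
  have "variation \<rho> x u u w = 0" "variation \<rho> x u w u = 0" "variation \<rho> x w u u = 0" for u w
    unfolding variation_def
    using form_swap(1)[of "br x u" u w] form_swap(2)[of w "br x u" u] swap13[of "br x u" w u]
    by (simp_all add: form_diag)
  moreover have "linear (\<lambda>u. variation \<rho> x u v w)" "linear (\<lambda>v. variation \<rho> x u v w)"
    "linear (\<lambda>w. variation \<rho> x u v w)" for u v w
    by (simp_all add: linear_iff variation_def form_simps b distrib_left)
  ultimately show ?thesis by (simp add: three_form_def)
qed

text \<open>No Jacobi identity is assumed: the last term is rewritten by skewness of ad x, the other
  two by antisymmetry of the bracket.\<close>

lemma variation_jacobi:
  "variation \<rho> x u v w = - ((br x (br u v) + br u (br v x) + br v (br x u)) \<bullet> w)"
proof -
  have "\<rho> u v (br x w) = - (br x (br u v) \<bullet> w)"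
    using br_skew[of x "br u v" w] br_inner[of u v "br x w"] by simp
  moreover have "\<rho> (br x u) v w = - (br v (br x u) \<bullet> w)"
    using br_swap[of "br x u" v] br_inner[of "br x u" v w] by simp
  moreover have "\<rho> u (br x v) w = - (br u (br v x) \<bullet> w)"
    using br_swap[of x v] br_inner[of u "br x v" w] linear_neg[OF br_linear(1), of u "br v x"] by simp
  ultimately show ?thesis by (simp add: variation_def inner_add_left)
qed

section \<open>Commutation relations between x, A and B_x\<close>

lemma cl_form_anticommutator: "cl x (A s) + A (cl x s) = - B x s"
proof -
  let ?r = "\<lambda>i j k. \<rho> (e i) (e j) (e k)"
  \<comment> \<open>Passing x through three factors gives the sign -1, so the anticommutator leaves
    only terms in which x is contracted with one factor. After summation each of the three is -2
    B_x, and the total -6 B_x matches the factor 6 of \<open>form_sum\<close>.\<close>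
  have sw: "cl x (cl u (cl v (cl w s))) + cl u (cl v (cl w (cl x s))) =
     - (2 * (x \<bullet> u)) *\<^sub>R cl v (cl w s) + (2 * (x \<bullet> v)) *\<^sub>R cl u (cl w s)
     - (2 * (x \<bullet> w)) *\<^sub>R cl u (cl v s)" for u v w
    by (simp add: cl_swap[of x u] cl_swap[of x v] cl_swap[of x w] cl_simps algebra_simps)
  have "6 *\<^sub>R (cl x (A s) + A (cl x s)) = (\<Sum>i\<in>I. \<Sum>j\<in>I. \<Sum>k\<in>I.
      ?r i j k *\<^sub>R (cl x (cl (e i) (cl (e j) (cl (e k) s))) + cl (e i) (cl (e j) (cl (e k) (cl x s)))))"
    by (simp add: form_sum[OF form] cl_simps cl_sum sum.distrib scaleR_add_right)
  also have "\<dots> = - 2 *\<^sub>R (\<Sum>i\<in>I. \<Sum>j\<in>I. \<Sum>k\<in>I. ((x \<bullet> e i) * ?r i j k) *\<^sub>R cl (e j) (cl (e k) s))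
     + 2 *\<^sub>R (\<Sum>i\<in>I. \<Sum>j\<in>I. \<Sum>k\<in>I. ((x \<bullet> e j) * ?r i j k) *\<^sub>R cl (e i) (cl (e k) s))
     - 2 *\<^sub>R (\<Sum>i\<in>I. \<Sum>j\<in>I. \<Sum>k\<in>I. ((x \<bullet> e k) * ?r i j k) *\<^sub>R cl (e i) (cl (e j) s))"
    unfolding sw
    by (simp add: sum.distrib sum_subtractf sum_negf scaleR_sum_right algebra_simps)
  also have "(\<Sum>i\<in>I. \<Sum>j\<in>I. \<Sum>k\<in>I. ((x \<bullet> e k) * ?r i j k) *\<^sub>R cl (e i) (cl (e j) s)) = B x s"
    by (simp only: contract_form[OF lin(3)] contr_def)
  also have "(\<Sum>i\<in>I. \<Sum>j\<in>I. \<Sum>k\<in>I. ((x \<bullet> e j) * ?r i j k) *\<^sub>R cl (e i) (cl (e k) s)) = - B x s"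
  proof -
    have "(\<Sum>j\<in>I. \<Sum>k\<in>I. ((x \<bullet> e j) * ?r i j k) *\<^sub>R cl (e i) (cl (e k) s)) =
        - (\<Sum>k\<in>I. \<rho> (e i) (e k) x *\<^sub>R cl (e i) (cl (e k) s))" for i
      by (subst sum.swap)
        (simp only: contract_form[OF lin(2)] form_swap(2)[of _ x] sum_negf scaleR_minus_left)
    then show ?thesis by (simp only: contr_def sum_negf)
  qed
  also have "(\<Sum>i\<in>I. \<Sum>j\<in>I. \<Sum>k\<in>I. ((x \<bullet> e i) * ?r i j k) *\<^sub>R cl (e j) (cl (e k) s)) = B x s"
    by (subst sum_rotate) (simp only: contract_form[OF lin(1)] contr_def form_cyclic[of x])
  finally have "6 *\<^sub>R (cl x (A s) + A (cl x s)) = 6 *\<^sub>R (- B x s)"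
    by (simp add: scaleR_3_6)
  then show ?thesis by (simp only: scaleR_cancel_left) simp
qed

lemma cl_br: "(\<Sum>i\<in>I. \<rho> x v (e i) *\<^sub>R cl (e i) s) = cl (br x v) s"
  by (simp add: bracket_def cl_sum cl_simps)

text \<open>Passing v through two factors gives the sign +1, so a commutator remains; each of its
  two contraction terms is 2 [x,v]. Thus B_x / 4 lifts ad x to the spinors.\<close>

lemma contr_cl: "B x (cl v s) = cl v (B x s) + 4 *\<^sub>R cl (br x v) s"
proof -
  have sw: "cl a (cl b (cl v s)) = cl v (cl a (cl b s)) + (2 * (v \<bullet> a)) *\<^sub>R cl b s
     - (2 * (v \<bullet> b)) *\<^sub>R cl a s" for a b
    by (simp add: cl_swap[of v a] cl_swap[of v b] cl_simps algebra_simps)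
  have "B x (cl v s) = cl v (B x s)
     + 2 *\<^sub>R (\<Sum>i\<in>I. \<Sum>j\<in>I. ((v \<bullet> e i) * \<rho> (e i) (e j) x) *\<^sub>R cl (e j) s)
     - 2 *\<^sub>R (\<Sum>i\<in>I. \<Sum>j\<in>I. ((v \<bullet> e j) * \<rho> (e i) (e j) x) *\<^sub>R cl (e i) s)"
    unfolding contr_def sw
    by (simp add: sum.distrib sum_subtractf scaleR_sum_right cl_sum cl_simps algebra_simps)
  also have "(\<Sum>i\<in>I. \<Sum>j\<in>I. ((v \<bullet> e j) * \<rho> (e i) (e j) x) *\<^sub>R cl (e i) s) = - cl (br x v) s"
    by (simp only: contract_form[OF lin(2)] form_cyclic[of _ v x] form_swap(1)[of v x]
        sum_negf scaleR_minus_left cl_br)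
  also have "(\<Sum>i\<in>I. \<Sum>j\<in>I. ((v \<bullet> e i) * \<rho> (e i) (e j) x) *\<^sub>R cl (e j) s) = cl (br x v) s"
    by (subst sum.swap) (simp only: contract_form[OF lin(1)] form_cyclic[of x v, symmetric] cl_br)
  finally show ?thesis by (simp flip: scaleR_left_distrib)
qed

text \<open>By \<open>contr_cl\<close> the commutator with B_x is a derivation acting as 4 ad x on
  each vector factor. \<open>contract_skew\<close> transfers ad x to the coefficients of \<rho>,
  whence the minus sign.\<close>

lemma contr_form_commutator:
  "B x (A s) = A (B x s) - 4 *\<^sub>R clifford_form cl e (variation \<rho> x) s"
proof -
  let ?r = "\<lambda>i j k. \<rho> (e i) (e j) (e k)" and ?b = "\<lambda>i. br x (e i)"
  note Bl = linear_sum[OF contr_linear] linear_scale[OF contr_linear]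
  have sw: "B x (cl u (cl v (cl w s))) = cl u (cl v (cl w (B x s))) + 4 *\<^sub>R cl (br x u) (cl v (cl w s))
      + 4 *\<^sub>R cl u (cl (br x v) (cl w s)) + 4 *\<^sub>R cl u (cl v (cl (br x w) s))" for u v w
    by (simp add: contr_cl cl_simps algebra_simps)
  have "6 *\<^sub>R B x (A s) = 6 *\<^sub>R A (B x s)
     + 4 *\<^sub>R (\<Sum>i\<in>I. \<Sum>j\<in>I. \<Sum>k\<in>I. ?r i j k *\<^sub>R cl (?b i) (cl (e j) (cl (e k) s)))
     + 4 *\<^sub>R (\<Sum>i\<in>I. \<Sum>j\<in>I. \<Sum>k\<in>I. ?r i j k *\<^sub>R cl (e i) (cl (?b j) (cl (e k) s)))
     + 4 *\<^sub>R (\<Sum>i\<in>I. \<Sum>j\<in>I. \<Sum>k\<in>I. ?r i j k *\<^sub>R cl (e i) (cl (e j) (cl (?b k) s)))"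
    by (simp add: form_sum[OF form] Bl sw sum.distrib scaleR_add_right scaleR_sum_right mult_ac)
  also have "(\<Sum>i\<in>I. \<Sum>j\<in>I. \<Sum>k\<in>I. ?r i j k *\<^sub>R cl (e i) (cl (e j) (cl (?b k) s))) =
     - (\<Sum>i\<in>I. \<Sum>j\<in>I. \<Sum>k\<in>I. \<rho> (e i) (e j) (?b k) *\<^sub>R cl (e i) (cl (e j) (cl (e k) s)))"
    by (subst contract_skew[where f = "\<lambda>w. cl _ (cl _ (cl w s))", OF _ lin(3) br_skew])
      (simp_all add: linear_iff cl_simps sum_negf)
  \<comment> \<open>\<open>contract_skew\<close> treats an innermost sum, so the sum over
    \<open>j\<close> here, and the one over \<open>i\<close> below, is first moved inwards.\<close>
  also have "(\<Sum>i\<in>I. \<Sum>j\<in>I. \<Sum>k\<in>I. ?r i j k *\<^sub>R cl (e i) (cl (?b j) (cl (e k) s))) =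
     - (\<Sum>i\<in>I. \<Sum>j\<in>I. \<Sum>k\<in>I. \<rho> (e i) (?b j) (e k) *\<^sub>R cl (e i) (cl (e j) (cl (e k) s)))"
  proof -
    have "(\<Sum>j\<in>I. \<Sum>k\<in>I. ?r i j k *\<^sub>R cl (e i) (cl (?b j) (cl (e k) s))) =
       - (\<Sum>j\<in>I. \<Sum>k\<in>I. \<rho> (e i) (?b j) (e k) *\<^sub>R cl (e i) (cl (e j) (cl (e k) s)))" for i
      by (subst (1 2) sum.swap, subst contract_skew[where f = "\<lambda>w. cl _ (cl w (cl _ s))", OF _ lin(2) br_skew])
        (simp_all add: linear_iff cl_simps sum_negf)
    then show ?thesis by (simp add: sum_negf)
  qed
  also have "(\<Sum>i\<in>I. \<Sum>j\<in>I. \<Sum>k\<in>I. ?r i j k *\<^sub>R cl (?b i) (cl (e j) (cl (e k) s))) =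
     - (\<Sum>i\<in>I. \<Sum>j\<in>I. \<Sum>k\<in>I. \<rho> (?b i) (e j) (e k) *\<^sub>R cl (e i) (cl (e j) (cl (e k) s)))"
    by (subst (1 2) sum_rotate, subst contract_skew[where f = "\<lambda>w. cl w (cl _ (cl _ s))", OF _ lin(1) br_skew])
      (simp_all add: linear_iff cl_simps sum_negf)
  finally have "6 *\<^sub>R B x (A s) = 6 *\<^sub>R (A (B x s) - 4 *\<^sub>R clifford_form cl e (variation \<rho> x) s)"
    unfolding form_sum[OF variation_form] variation_def
    by (simp add: sum.distrib algebra_simps scaleR_sum_right)
  then show ?thesis by (simp only: scaleR_cancel_left) simp
qed

text \<open>Injectivity of the Clifford action, by lowering the degree: from A to B_x, then from B_x
  to the vectors [x,y], which act faithfully by \<open>cl_eq_0_imp\<close>.\<close>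

lemma form_eq_0:
  assumes "\<And>s. A s = 0"
  shows "\<rho> x y z = 0"
proof -
  have "B x s = 0" for x s using cl_form_anticommutator[of x s] by (simp add: assms cl_simps)
  then have "cl (br x y) s = 0" for s using contr_cl[of x y s] by (simp add: cl_simps)
  then have "br x y = 0" by (rule cl_eq_0_imp)
  then show ?thesis using br_inner[of x y z] by simp
qed

lemma variation_eq_0_if_involution:
  assumes "\<And>s. A (A s) = s"
  shows "variation \<rho> x u v w = 0"
proof -
  interpret var: spin_form e cl "variation \<rho> x"
    by unfold_locales (rule variation_form)
  have B: "B x s = - (cl x (A s) + A (cl x s))" for s
    by (simp add: cl_form_anticommutator)
  \<comment> \<open>Since A A = 1, both A (x A + A x) and (x A + A x) A equal A x A + x.\<close>
  have "B x (A s) = A (B x s)" for s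
    unfolding B
    by (simp add: assms linear_neg[OF clifford_form_linear] linear_add[OF clifford_form_linear]
        linear_diff[OF clifford_form_linear])
  then have "clifford_form cl e (variation \<rho> x) s = 0" for s
    using contr_form_commutator[of x s] by simp
  then show ?thesis by (rule var.form_eq_0)
qed

section \<open>The sum of the squares B_k B_k and the norm of the form\<close>

lemma form_norm_square: "(form_norm e \<rho>)\<^sup>2 = (1 / 6) * (\<Sum>i\<in>I. \<Sum>j\<in>I. br (e i) (e j) \<bullet> br (e i) (e j))"
proof -
  have sq: "(\<Sum>k\<in>I. (\<rho> x y (e k))\<^sup>2) = br x y \<bullet> br x y" for x y
  proof -
    have "br x y \<bullet> br x y = (\<Sum>k\<in>I. \<rho> x y (e k) * (br x y \<bullet> e k))"
      by (subst (2) bracket_def) (simp add: inner_sum_right)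
    then show ?thesis by (simp add: br_inner power2_eq_square)
  qed
  have "(form_norm e \<rho>)\<^sup>2 = (\<Sum>(i, j, k)\<in>index_triples. (\<rho> (e i) (e j) (e k))\<^sup>2)"
    by (simp add: form_norm_def sum_nonneg split_def)
  also have "\<dots> = (1 / 6) *\<^sub>R (\<Sum>i\<in>I. \<Sum>j\<in>I. \<Sum>k\<in>I. (\<rho> (e i) (e j) (e k))\<^sup>2)"
    by (rule sum_index_triples; simp only: power2_eq_iff form_diag power_zero_numeral)
      (metis form_swap)+
  finally show ?thesis by (simp add: sq)
qed

lemma contr_linear_vector: "linear (\<lambda>x. B x s)"
  by (rule linearI)
    (simp_all add: contr_def form_simps scaleR_add_left sum.distrib scaleR_sum_right)

lemma form_eq_contr: "6 *\<^sub>R A s = (\<Sum>k\<in>I. B (e k) (cl (e k) s))"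
proof -
  have "(\<Sum>k\<in>I. B (e k) (cl (e k) s)) =
      (\<Sum>i\<in>I. \<Sum>j\<in>I. \<Sum>k\<in>I. \<rho> (e i) (e j) (e k) *\<^sub>R cl (e i) (cl (e j) (cl (e k) s)))"
    unfolding contr_def by (rule sum_rotate)
  then show ?thesis by (simp add: form_sum[OF form])
qed

lemma contr_eq_br: "B y s = (\<Sum>l\<in>I. cl (e l) (cl (br y (e l)) s))"
  by (simp add: contr_def cl_br[symmetric] cl_sum cl_simps form_cyclic[of y])

text \<open>The outer B is expanded and its third index contracted with the inner one, giving B at
  [e_i,e_j]; \<open>contr_eq_br\<close> then puts a double bracket into the last slot, where the
  Jacobi identity can act.\<close>

lemma contr_square_sum:
  "(\<Sum>k\<in>I. B (e k) (B (e k) s)) =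
    (\<Sum>i\<in>I. \<Sum>j\<in>I. \<Sum>l\<in>I. cl (e i) (cl (e j) (cl (e l) (cl (br (br (e i) (e j)) (e l)) s))))"
proof -
  have B_br: "(\<Sum>k\<in>I. \<rho> x y (e k) *\<^sub>R B (e k) s) = B (br x y) s" for x y
    by (simp only: bracket_def linear_sum[OF contr_linear_vector] linear_scale[OF contr_linear_vector])
  have "(\<Sum>k\<in>I. B (e k) (B (e k) s)) =
      (\<Sum>k\<in>I. \<Sum>i\<in>I. \<Sum>j\<in>I. \<rho> (e i) (e j) (e k) *\<^sub>R cl (e i) (cl (e j) (B (e k) s)))"
    by (subst (1) contr_def) (rule refl)
  also have "\<dots> = (\<Sum>i\<in>I. \<Sum>j\<in>I. cl (e i) (cl (e j) (B (br (e i) (e j)) s)))"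
    by (subst sum_rotate) (simp only: B_br[symmetric] cl_sum cl_simps)
  also have "\<dots> = (\<Sum>i\<in>I. \<Sum>j\<in>I. \<Sum>l\<in>I. cl (e i) (cl (e j) (cl (e l) (cl (br (br (e i) (e j)) (e l)) s))))"
    by (simp only: contr_eq_br cl_sum)
  finally show ?thesis .
qed

text \<open>For fixed x the map taking v to [[x,v],x] is -(ad x)^2, which is self-adjoint and pairs
  with v to |[x,v]|^2. So \<open>contract_selfadjoint\<close> leaves its trace, and by
  \<open>form_norm_square\<close> the traces for x = e_i add up to 6 |\<rho>|^2.\<close>

lemma br_br_contraction:
  "(\<Sum>i\<in>I. \<Sum>j\<in>I. cl (e j) (cl (br (br (e i) (e j)) (e i)) s)) = - (6 * (form_norm e \<rho>)\<^sup>2) *\<^sub>R s"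
proof -
  have K: "br (br x u) x \<bullet> v = br x v \<bullet> br x u" for x u v
    by (simp add: br_inner form_cyclic[of "br x u"])
  have "(\<Sum>j\<in>I. cl (e j) (cl (br (br x (e j)) x) s)) = - (\<Sum>j\<in>I. br x (e j) \<bullet> br x (e j)) *\<^sub>R s"
    for x
  proof (subst contract_selfadjoint[where K = "\<lambda>v. br (br x v) x"])
    show "linear (\<lambda>v. br (br x v) x)"
      using linear_compose[OF br_linear(1) br_linear(2), of x x] by (simp add: o_def)
    show "br (br x u) x \<bullet> v = u \<bullet> br (br x v) x" for u v
      using K[of x u v] K[of x v u] by (simp add: inner_commute)
  qed (simp add: K inner_commute[of _ "br (br _ _) _"])
  then show ?thesis
    by (simp add: form_norm_square sum_negf flip: scaleR_sum_left)
qed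

text \<open>This and \<open>cl_rotate'\<close> bring cyclically permuted products back to the order
  u v w; two transpositions keep the sign and produce two scalar contractions.\<close>

lemma cl_rotate:
  "cl w (cl u (cl v t)) = cl u (cl v (cl w t)) + 2 *\<^sub>R ((v \<bullet> w) *\<^sub>R cl u t) - 2 *\<^sub>R ((u \<bullet> w) *\<^sub>R cl v t)"
  by (simp add: cl_swap[of w u] cl_swap[of w v] cl_simps inner_commute[of w])

lemma cl_rotate':
  "cl v (cl w (cl u t)) = cl u (cl v (cl w t)) + 2 *\<^sub>R ((u \<bullet> v) *\<^sub>R cl w t) - 2 *\<^sub>R ((u \<bullet> w) *\<^sub>R cl v t)"
  by (simp add: cl_swap[of w u] cl_swap[of v u] cl_simps inner_commute[of _ u])

lemma contr_square_sum_if_jacobi: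
  assumes J: "\<And>x u v. br x (br u v) + br u (br v x) + br v (br x u) = 0"
  shows "(\<Sum>k\<in>I. B (e k) (B (e k) s)) = - (12 * (form_norm e \<rho>)\<^sup>2) *\<^sub>R s"
proof -
  define q where "q = (\<lambda>i j l. br (br (e i) (e j)) (e l))"
  define X where "X = (\<Sum>i\<in>I. \<Sum>j\<in>I. cl (e j) (cl (q i j i) s))"
  let ?S = "\<Sum>i\<in>I. \<Sum>j\<in>I. \<Sum>l\<in>I. cl (e i) (cl (e j) (cl (e l) (cl (q i j l) s)))"
  have "q i j l = - br (e l) (br (e i) (e j))" for i j l
    by (simp only: q_def br_swap[of "br (e i) (e j)" "e l"])
  then have "q i j l + q j l i + q l i j =
      - (br (e i) (br (e j) (e l)) + br (e j) (br (e l) (e i)) + br (e l) (br (e i) (e j)))" for i j l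
    by (simp only: minus_add_distrib ac_simps)
  then have "0 = (\<Sum>i\<in>I. \<Sum>j\<in>I. \<Sum>l\<in>I. cl (e i) (cl (e j) (cl (e l) (cl (q i j l + q j l i + q l i j) s))))"
    by (simp add: J cl_simps)
  also have "\<dots> = ?S
      + (\<Sum>i\<in>I. \<Sum>j\<in>I. \<Sum>l\<in>I. cl (e i) (cl (e j) (cl (e l) (cl (q j l i) s))))
      + (\<Sum>i\<in>I. \<Sum>j\<in>I. \<Sum>l\<in>I. cl (e i) (cl (e j) (cl (e l) (cl (q l i j) s))))"
    by (simp only: cl_simps sum.distrib)
  \<comment> \<open>The indices are renamed so that all three sums carry the same double bracket
    \<open>q i j l\<close> and differ only in the order of the Clifford factors.\<close>
  also have "(\<Sum>i\<in>I. \<Sum>j\<in>I. \<Sum>l\<in>I. cl (e i) (cl (e j) (cl (e l) (cl (q j l i) s)))) =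
      (\<Sum>i\<in>I. \<Sum>j\<in>I. \<Sum>l\<in>I. cl (e l) (cl (e i) (cl (e j) (cl (q i j l) s))))"
    by (rule sum_rotate)
  also have "(\<Sum>i\<in>I. \<Sum>j\<in>I. \<Sum>l\<in>I. cl (e i) (cl (e j) (cl (e l) (cl (q l i j) s)))) =
      (\<Sum>i\<in>I. \<Sum>j\<in>I. \<Sum>l\<in>I. cl (e j) (cl (e l) (cl (e i) (cl (q i j l) s))))"
    by (rule sum_rotate[symmetric])
  also have "(\<Sum>i\<in>I. \<Sum>j\<in>I. \<Sum>l\<in>I. cl (e l) (cl (e i) (cl (e j) (cl (q i j l) s)))) =
    (\<Sum>i\<in>I. \<Sum>j\<in>I. \<Sum>l\<in>I. cl (e i) (cl (e j) (cl (e l) (cl (q i j l) s)))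
      + 2 *\<^sub>R ((e j \<bullet> e l) *\<^sub>R cl (e i) (cl (q i j l) s))
      - 2 *\<^sub>R ((e i \<bullet> e l) *\<^sub>R cl (e j) (cl (q i j l) s)))"
    by (intro sum.cong refl cl_rotate)
  also have "\<dots> = ?S + 2 *\<^sub>R (\<Sum>i\<in>I. \<Sum>j\<in>I. \<Sum>l\<in>I. (e j \<bullet> e l) *\<^sub>R cl (e i) (cl (q i j l) s))
      - 2 *\<^sub>R (\<Sum>i\<in>I. \<Sum>j\<in>I. \<Sum>l\<in>I. (e i \<bullet> e l) *\<^sub>R cl (e j) (cl (q i j l) s))"
    by (simp only: sum.distrib sum_subtractf scaleR_sum_right)
  also have "(\<Sum>i\<in>I. \<Sum>j\<in>I. \<Sum>l\<in>I. cl (e j) (cl (e l) (cl (e i) (cl (q i j l) s)))) =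
    (\<Sum>i\<in>I. \<Sum>j\<in>I. \<Sum>l\<in>I. cl (e i) (cl (e j) (cl (e l) (cl (q i j l) s)))
      + 2 *\<^sub>R ((e i \<bullet> e j) *\<^sub>R cl (e l) (cl (q i j l) s))
      - 2 *\<^sub>R ((e i \<bullet> e l) *\<^sub>R cl (e j) (cl (q i j l) s)))"
    by (intro sum.cong refl cl_rotate')
  also have "\<dots> = ?S + 2 *\<^sub>R (\<Sum>i\<in>I. \<Sum>j\<in>I. \<Sum>l\<in>I. (e i \<bullet> e j) *\<^sub>R cl (e l) (cl (q i j l) s))
      - 2 *\<^sub>R (\<Sum>i\<in>I. \<Sum>j\<in>I. \<Sum>l\<in>I. (e i \<bullet> e l) *\<^sub>R cl (e j) (cl (q i j l) s))"
    by (simp only: sum.distrib sum_subtractf scaleR_sum_right)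
  \<comment> \<open>The contractions left by the reordering are \<open>X\<close> for i = l,
    \<open>- X\<close> for j = l by antisymmetry of the inner bracket, and 0 for i = j.\<close>
  also have "(\<Sum>i\<in>I. \<Sum>j\<in>I. \<Sum>l\<in>I. (e i \<bullet> e l) *\<^sub>R cl (e j) (cl (q i j l) s)) = X"
    unfolding X_def q_def
    by (subst contract[where f = "\<lambda>w. cl _ (cl (br _ w) s)"])
      (simp_all add: linear_iff cl_simps bilinear_radd[OF br_bilinear] bilinear_rmul[OF br_bilinear])
  also have "(\<Sum>i\<in>I. \<Sum>j\<in>I. \<Sum>l\<in>I. (e j \<bullet> e l) *\<^sub>R cl (e i) (cl (q i j l) s)) = - X"
  proof -
    have "(\<Sum>i\<in>I. \<Sum>j\<in>I. \<Sum>l\<in>I. (e j \<bullet> e l) *\<^sub>R cl (e i) (cl (q i j l) s)) =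
        (\<Sum>i\<in>I. \<Sum>j\<in>I. cl (e i) (cl (q i j j) s))"
      unfolding q_def
      by (subst contract[where f = "\<lambda>w. cl _ (cl (br _ w) s)"])
        (simp_all add: linear_iff cl_simps bilinear_radd[OF br_bilinear] bilinear_rmul[OF br_bilinear])
    also have "\<dots> = (\<Sum>j\<in>I. \<Sum>i\<in>I. cl (e i) (cl (q i j j) s))" by (rule sum.swap)
    also have "\<dots> = (\<Sum>j\<in>I. \<Sum>i\<in>I. cl (e i) (cl (- q j i j) s))"
      unfolding q_def
      by (intro sum.cong refl) (metis br_swap bilinear_lneg[OF br_bilinear])
    finally show ?thesis by (simp add: X_def cl_simps sum_negf)
  qed
  also have "(\<Sum>i\<in>I. \<Sum>j\<in>I. \<Sum>l\<in>I. (e i \<bullet> e j) *\<^sub>R cl (e l) (cl (q i j l) s)) = 0"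
  proof -
    have "(\<Sum>j\<in>I. \<Sum>l\<in>I. (e i \<bullet> e j) *\<^sub>R cl (e l) (cl (q i j l) s)) =
        (\<Sum>l\<in>I. cl (e l) (cl (q i i l) s))" for i
      unfolding q_def
      by (subst sum.swap, subst contract[where f = "\<lambda>w. cl _ (cl (br (br _ w) _) s)"])
        (simp_all add: linear_iff cl_simps bilinear_radd[OF br_bilinear] bilinear_rmul[OF br_bilinear]
          bilinear_ladd[OF br_bilinear] bilinear_lmul[OF br_bilinear])
    then show ?thesis by (simp add: q_def br_diag bilinear_lzero[OF br_bilinear] cl_simps)
  qed
  \<comment> \<open>The three sums are \<open>?S\<close>, \<open>?S\<close> - 4 \<open>X\<close> and
    \<open>?S\<close> - 2 \<open>X\<close>, and their total is 0.\<close>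
  finally have "3 *\<^sub>R ?S = 3 *\<^sub>R (2 *\<^sub>R X)" by (simp add: scaleR_3_6 algebra_simps)
  then have "?S = 2 *\<^sub>R X" by (simp only: scaleR_cancel_left) simp
  then show ?thesis
    unfolding contr_square_sum X_def q_def br_br_contraction by simp
qed

lemma form_square_if_jacobi:
  assumes J: "\<And>x u v. br x (br u v) + br u (br v x) + br v (br x u) = 0"
  shows "A (A s) = (form_norm e \<rho>)\<^sup>2 *\<^sub>R s"
proof -
  have "clifford_form cl e (variation \<rho> x) t = 0" for x t
    by (simp add: clifford_form_def variation_jacobi J)
  then have comm: "B x (A t) = A (B x t)" for x t by (simp add: contr_form_commutator)
  note Al = clifford_form_linear[of \<rho>] and Bl = contr_linear[of \<rho>]
  have anti: "cl x (A s) = - A (cl x s) - B x s" for x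
    using cl_form_anticommutator[of x s] by (simp add: algebra_simps eq_neg_iff_add_eq_0)
  \<comment> \<open>The outer A is expanded by \<open>form_eq_contr\<close>, \<open>anti\<close>
    moves each e_k past the inner A, and \<open>comm\<close> exchanges B_k with A.\<close>
  have "6 *\<^sub>R A (A s) = (\<Sum>k\<in>I. - A (B (e k) (cl (e k) s)) - B (e k) (B (e k) s))"
    unfolding form_eq_contr anti by (simp add: linear_diff[OF Bl] linear_neg[OF Bl] comm)
  also have "\<dots> = - A (6 *\<^sub>R A s) - (\<Sum>k\<in>I. B (e k) (B (e k) s))"
    by (simp add: form_eq_contr linear_sum[OF Al] sum_subtractf sum_negf)
  \<comment> \<open>The constant 12 is split as 2 * 6 to fit
    \<open>eq_uminus_if_twice\<close>.\<close>
  also have "\<dots> = - 6 *\<^sub>R A (A s) - 2 *\<^sub>R (- (6 * (form_norm e \<rho>)\<^sup>2) *\<^sub>R s)"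
    by (simp add: contr_square_sum_if_jacobi[OF J] linear_scale[OF Al])
  finally have "6 *\<^sub>R A (A s) = - (- (6 * (form_norm e \<rho>)\<^sup>2) *\<^sub>R s)"
    by (intro eq_uminus_if_twice) simp
  then have "6 *\<^sub>R A (A s) = 6 *\<^sub>R ((form_norm e \<rho>)\<^sup>2 *\<^sub>R s)" by simp
  then show ?thesis by (simp only: scaleR_cancel_left) simp
qed

text \<open>The coefficients with increasing indices vanish, so A = 0; \<open>form_eq_0\<close> then
  takes the place of an expansion of \<rho> in the frame.\<close>

lemma form_eq_0_if_norm:
  assumes "form_norm e \<rho> = 0"
  shows "\<rho> x y z = 0"
proof (rule form_eq_0)
  have "(\<Sum>t\<in>index_triples. case t of (i, j, k) \<Rightarrow> (\<rho> (e i) (e j) (e k))\<^sup>2) = 0"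
    using assms by (simp add: form_norm_def)
  then have "\<forall>t\<in>index_triples. (case t of (i, j, k) \<Rightarrow> (\<rho> (e i) (e j) (e k))\<^sup>2) = 0"
    by (subst (asm) sum_nonneg_eq_0_iff) (auto simp: finite_index_triples)
  then show "A s = 0" for s
    unfolding clifford_form_def by (intro sum.neutral) auto
qed

end

section \<open>Isometric 3-forms and metric Lie brackets\<close>

theorem theorem1p12:
  fixes e :: "nat \<Rightarrow> 'v::euclidean_space"
    and cl :: "'v \<Rightarrow> 's::euclidean_space \<Rightarrow> 's"
  assumes "DIM('v) = 8"
    and "orthonormal_frame e"
    and "spinor_module cl"
  shows "(\<forall>\<rho>\<in>isometric_forms cl e.
            form_norm e \<rho> = 1 \<and>
            (\<exists>br. lie_bracket br \<and>
                  (\<forall>x y z. \<rho> x y z = br x y \<bullet> z) \<and>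
                  (\<forall>\<phi>\<in>adjoint_group br. orthogonal_transformation \<phi>))) \<and>
         (\<forall>br. lie_bracket br \<and>
               (\<forall>\<phi>\<in>adjoint_group br. \<forall>x y. \<phi> x \<bullet> \<phi> y = x \<bullet> y) \<and>
               (\<exists>x y. br x y \<noteq> 0) \<longrightarrow>
               (\<lambda>x y z. (br x y \<bullet> z) / form_norm e (\<lambda>x y z. br x y \<bullet> z)) \<in> isometric_forms cl e)"
proof (intro conjI ballI allI impI)
  fix \<rho> assume "\<rho> \<in> isometric_forms cl e"
  then have form: "three_form \<rho>" and inv: "\<And>s. clifford_form cl e \<rho> (clifford_form cl e \<rho> s) = s"
    by (auto simp: isometric_forms_iff[OF assms(2,3)])
  interpret spin_form e cl \<rho> using assms form by unfold_locales
  have J: "br x (br u v) + br u (br v x) + br v (br x u) = 0" for x u v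
  proof -
    \<comment> \<open>The vanishing variation is evaluated at the Jacobiator itself, whose squared
      norm is therefore 0.\<close>
    let ?j = "br x (br u v) + br u (br v x) + br v (br x u)"
    have "?j \<bullet> ?j = 0"
      using variation_jacobi[of x u v ?j] variation_eq_0_if_involution[OF inv] by simp
    then show ?thesis by simp
  qed
  \<comment> \<open>One nonzero spinor suffices to compare A A = 1 with A A = |\<rho>|^2.\<close>
  obtain s :: 's where "s \<in> Basis" by (meson nonempty_Basis ex_in_conv)
  then have "s \<noteq> 0" by auto
  moreover have "(form_norm e \<rho>)\<^sup>2 *\<^sub>R s = 1 *\<^sub>R s" using form_square_if_jacobi[OF J, of s] inv by simp
  ultimately have "(form_norm e \<rho>)\<^sup>2 = 1" by (simp only: scaleR_cancel_right) simp
  moreover have "form_norm e \<rho> \<ge> 0" by (simp add: form_norm_def sum_nonneg split_def)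
  ultimately show "form_norm e \<rho> = 1" by (simp add: power2_eq_1_iff)
  show "\<exists>br. lie_bracket br \<and> (\<forall>x y z. \<rho> x y z = br x y \<bullet> z) \<and>
      (\<forall>\<phi>\<in>adjoint_group br. orthogonal_transformation \<phi>)"
    using br_bilinear br_diag J br_inner adjoint_group_orthogonal[OF br_bilinear br_skew]
    by (intro exI[of _ br]) (simp add: lie_bracket_def)
next
  fix br :: "'v \<Rightarrow> 'v \<Rightarrow> 'v"
  assume "lie_bracket br \<and> (\<forall>\<phi>\<in>adjoint_group br. \<forall>x y. \<phi> x \<bullet> \<phi> y = x \<bullet> y) \<and> (\<exists>x y. br x y \<noteq> 0)"
  then have bil: "bilinear br" and diag: "\<And>x. br x x = 0"
    and J: "\<And>x y z. br x (br y z) + br y (br z x) + br z (br x y) = 0"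
    and iso: "\<And>\<phi> x y. \<phi> \<in> adjoint_group br \<Longrightarrow> \<phi> x \<bullet> \<phi> y = x \<bullet> y"
    and nonzero: "\<exists>x y. br x y \<noteq> 0"
    by (auto simp: lie_bracket_def)
  define \<rho> where "\<rho> = (\<lambda>x y z. br x y \<bullet> z)"
  define N where "N = form_norm e \<rho>"
  note skew = skew_if_adjoint_group_isometric[OF bil iso]
  \<comment> \<open>Skewness makes \<rho> alternate in its last two arguments; with [x,x] = 0 this
    yields alternation in the outer two below.\<close>
  have yy: "br x y \<bullet> y = 0" for x y using skew[of x y y] by (simp add: inner_commute)
  have "br (x + y) (x + y) = br x x + br y x + (br x y + br y y)" for x y
    by (simp add: bilinear_ladd[OF bil] bilinear_radd[OF bil])
  then have "br y x + br x y = 0" for x y by (simp add: diag)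
  then have "br x y \<bullet> x = 0" for x y
    using yy[of y x] by (metis add_cancel_left_left inner_add_left inner_zero_left)
  then have form: "three_form \<rho>"
    using yy diag
    by (simp add: three_form_def \<rho>_def linear_iff inner_add_left inner_add_right bilinear_ladd[OF bil]
        bilinear_radd[OF bil] bilinear_lmul[OF bil] bilinear_rmul[OF bil])
  interpret S: spin_form e cl \<rho> using assms form by unfold_locales
  \<comment> \<open>By nondegeneracy of the metric the bracket rebuilt from \<rho> is the given one,
    so its Jacobi identity becomes available for the locale.\<close>
  have br: "S.br = br"
  proof (intro ext)
    show "S.br x y = br x y" for x y
      using S.br_inner[of x y] by (intro vector_eq_ldot[THEN iffD1]) (simp add: \<rho>_def inner_commute)
  qed
  \<comment> \<open>Norm zero would force \<rho> = 0; evaluated at z = [x,y] this makes every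
    bracket vanish, against \<open>nonzero\<close>.\<close>
  have "N \<noteq> 0"
  proof
    assume "N = 0"
    then have "br x y \<bullet> br x y = 0" for x y
      using S.form_eq_0_if_norm[of x y "br x y"] by (simp add: N_def \<rho>_def)
    then show False using nonzero by simp
  qed
  \<comment> \<open>Only the form is divided by \<open>N\<close>: the Jacobi identity is applied to
    the unscaled bracket, and A A = N^2 becomes 1 after scaling.\<close>
  let ?\<sigma> = "\<lambda>x y z. \<rho> x y z / N"
  have \<sigma>: "clifford_form cl e ?\<sigma> s = (1 / N) *\<^sub>R S.A s" for s
    by (simp add: clifford_form_def scaleR_sum_right split_def)
  have "three_form ?\<sigma>"
    using form by (simp add: three_form_def linear_iff add_divide_distrib)
  moreover have "clifford_form cl e ?\<sigma> (clifford_form cl e ?\<sigma> s) = s" for s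
    using S.form_square_if_jacobi[unfolded br, OF J, of s] \<open>N \<noteq> 0\<close>
    unfolding \<sigma> by (simp add: linear_scale[OF S.clifford_form_linear] N_def power2_eq_square)
  ultimately have "?\<sigma> \<in> isometric_forms cl e"
    by (simp add: isometric_forms_iff[OF assms(2,3)])
  then show "(\<lambda>x y z. (br x y \<bullet> z) / form_norm e (\<lambda>x y z. br x y \<bullet> z)) \<in> isometric_forms cl e"
    by (simp add: N_def \<rho>_def)
qed

end
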